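(* Let $X$ be a connected finite CW complex that admits a nontrivial strongly regular self-cover $p:X\to X$. Then the first Betti number satisfies $b_1(X)>0$.
   Context: A self-cover of a space $X$ is a covering map $p:X\to X$. It is nontrivial if its degree is $>1$, and strongly regular if for every $n\geq 1$ the iterate $p^n:X\to X$ is a regular (i.e. normal) covering. *)

theory Defs
  imports "HOL-Analysis.Analysis" "HOL-Homology.Homology" "HOL-Library.Extended_Nat"
begin

section \<open>CW complexes\<close>

text \<open>As everywhere with \<^const>\<open>Euclidean_space\<close>, points of real n-space are sequences vanishing
  from index n on. In dimension 0 the disc and the open disc are a point and the sphere is empty.\<close>

definition closed_disc :: "nat \<Rightarrow> (nat \<Rightarrow> real) set" where
  "closed_disc n = {x \<in> topspace (Euclidean_space n). (\<Sum>i<n. (x i)\<^sup>2) \<le> 1}"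

definition open_disc :: "nat \<Rightarrow> (nat \<Rightarrow> real) set" where
  "open_disc n = {x \<in> topspace (Euclidean_space n). (\<Sum>i<n. (x i)\<^sup>2) < 1}"

definition boundary_sphere :: "nat \<Rightarrow> (nat \<Rightarrow> real) set" where
  "boundary_sphere n = {x \<in> topspace (Euclidean_space n). (\<Sum>i<n. (x i)\<^sup>2) = 1}"

text \<open>Whitehead's definition. The open cells are the members of \<open>E\<close>; the cell \<open>e\<close> has dimension
  \<open>d e\<close> and characteristic map \<open>\<Phi> e\<close>. The last two conditions are closure finiteness and the
  weak topology.\<close>

definition CW_structure ::
  "'a topology \<Rightarrow> 'a set set \<Rightarrow> ('a set \<Rightarrow> nat) \<Rightarrow> ('a set \<Rightarrow> (nat \<Rightarrow> real) \<Rightarrow> 'a) \<Rightarrow> bool" where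
  "CW_structure X E d \<Phi> \<longleftrightarrow>
     Hausdorff_space X \<and>
     \<Union>E = topspace X \<and> pairwise disjnt E \<and>
     (\<forall>e\<in>E. continuous_map (subtopology (Euclidean_space (d e)) (closed_disc (d e))) X (\<Phi> e)) \<and>
     (\<forall>e\<in>E. homeomorphic_map (subtopology (Euclidean_space (d e)) (open_disc (d e)))
                (subtopology X e) (\<Phi> e)) \<and>
     (\<forall>e\<in>E. \<exists>F\<subseteq>E. finite F \<and> (\<forall>f\<in>F. d f < d e) \<and> \<Phi> e ` boundary_sphere (d e) \<subseteq> \<Union>F) \<and>
     (\<forall>A\<subseteq>topspace X. (\<forall>e\<in>E. closedin X (A \<inter> X closure_of e)) \<longrightarrow> closedin X A)"

definition finite_CW_complex :: "'a topology \<Rightarrow> bool" where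
  "finite_CW_complex X \<longleftrightarrow> (\<exists>E d \<Phi>. CW_structure X E d \<Phi> \<and> finite E)"

section \<open>Self-covers\<close>

text \<open>Regularity: deck transformations act transitively on every fibre.\<close>

definition deck_transformation ::
  "'a::topological_space set \<Rightarrow> ('a \<Rightarrow> 'b::topological_space) \<Rightarrow> ('a \<Rightarrow> 'a) \<Rightarrow> bool" where
  "deck_transformation C p f \<longleftrightarrow> (\<exists>g. homeomorphism C C f g) \<and> (\<forall>x\<in>C. p (f x) = p x)"

definition regular_covering_space ::
  "'a::topological_space set \<Rightarrow> ('a \<Rightarrow> 'b::topological_space) \<Rightarrow> 'b set \<Rightarrow> bool" where
  "regular_covering_space C p S \<longleftrightarrow>
     covering_space C p S \<and>
     (\<forall>x\<in>C. \<forall>y\<in>C. p x = p y \<longrightarrow> (\<exists>f. deck_transformation C p f \<and> f x = y))"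

text \<open>Only finite degrees occur below: fibres of a covering of a compact space by itself are
  finite, and \<^const>\<open>card\<close> is 0 on infinite sets.\<close>

definition covering_degree ::
  "'a::topological_space set \<Rightarrow> ('a \<Rightarrow> 'b::topological_space) \<Rightarrow> 'b set \<Rightarrow> nat \<Rightarrow> bool" where
  "covering_degree C p S k \<longleftrightarrow> covering_space C p S \<and> (\<forall>y\<in>S. card {x\<in>C. p x = y} = k)"

definition nontrivial_self_cover :: "'a::topological_space set \<Rightarrow> ('a \<Rightarrow> 'a) \<Rightarrow> bool" where
  "nontrivial_self_cover X p \<longleftrightarrow> (\<exists>k>1. covering_degree X p X k)"

definition strongly_regular_self_cover :: "'a::topological_space set \<Rightarrow> ('a \<Rightarrow> 'a) \<Rightarrow> bool" where
  "strongly_regular_self_cover X p \<longleftrightarrow>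
     covering_space X p X \<and> (\<forall>n\<ge>1. regular_covering_space X (p ^^ n) X)"

section \<open>Betti numbers\<close>

text \<open>Groups are written multiplicatively, so the integer combination with coefficients \<open>c\<close> is the
  product of the powers with exponents \<open>c\<close>.\<close>

definition int_independent :: "('a, 'b) monoid_scheme \<Rightarrow> 'a set \<Rightarrow> bool" where
  "int_independent G B \<longleftrightarrow>
     finite B \<and> B \<subseteq> carrier G \<and>
     (\<forall>c :: 'a \<Rightarrow> int. finprod G (\<lambda>b. b [^]\<^bsub>G\<^esub> c b) B = \<one>\<^bsub>G\<^esub> \<longrightarrow> (\<forall>b\<in>B. c b = 0))"

definition abelian_group_rank :: "('a, 'b) monoid_scheme \<Rightarrow> enat" where
  "abelian_group_rank G = (SUP B \<in> {B. int_independent G B}. enat (card B))"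

definition betti_number :: "nat \<Rightarrow> 'a topology \<Rightarrow> enat" where
  "betti_number n X = abelian_group_rank (homology_group (int n) X)"

end

theory Submission
  imports Defs "HOL-Algebra.Bij"
begin

text \<open>Let \<open>k\<close> be the degree of \<open>p\<close> and \<open>D n\<close> the deck group of \<open>p ^^ n\<close>, a finite group of order \<open>k ^ n\<close>.
A deck transformation of \<open>p ^^ m\<close> is also one of \<open>p ^^ n\<close> for \<open>n \<ge> m\<close>, so the \<open>D n\<close> increase to a group \<open>G\<close>.
Regularity of all iterates yields an endomorphism \<open>\<Phi>\<close> of \<open>G\<close> determined by \<open>\<Phi> f \<circ> p = p \<circ> f\<close>; it is
surjective and the kernel of \<open>\<Phi> ^^ j\<close> is \<open>D j\<close> (\<open>shift_onto\<close>, \<open>shift_pow_kernel\<close>).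

Because \<open>X\<close> is a finite complex, there are finitely many loops whose monodromies generate \<open>D n\<close> for all
\<open>n\<close> simultaneously (\<open>finitely_many_loops_generate\<close>). Hence, for a finite group \<open>Q\<close>, there are only finitely many
homomorphisms from \<open>G\<close> to \<open>Q\<close>. Precomposition with \<open>\<Phi>\<close> is an injective, hence bijective, self-map of
this finite set, so every such homomorphism factors through all the powers of \<open>\<Phi>\<close> and is trivial. In particular
\<open>G\<close> acts trivially by conjugation on each finite normal subgroup \<open>D j\<close>, and \<open>G\<close> is abelian
(\<open>uniformly_generated_imp_comm_group\<close>).

Monodromy with values in the abelian group \<open>D n\<close> is a singular 1-cocycle, so it depends on homology classes only
(\<open>monodromy_torsion\<close>). If \<open>b_1\<close> were 0, each of the finitely many loops would have a finite order \<open>m \<gamma>\<close> in the first homology group.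
These orders do not depend on \<open>n\<close>, whereas they would bound the order \<open>k ^ n\<close> of \<open>D n\<close> by their product for every \<open>n\<close>.

The existence of the loops replaces finite generation of the fundamental group. It is proved by attaching one cell at a
time, for the following dual statement about coverings: a set of points over the vertices which is stable under transport along
the edges is cut out by a decomposition of the covering space into two closed pieces
(\<open>finite_CW_transport_graph\<close>). For a connected covering space one of the pieces is empty.\<close>

section \<open>Lifting over contractible domains\<close>

text \<open>The set on which two lifts agree is open because \<open>p\<close> is locally injective, and its complement is open because
distinct sheets over an evenly covered set are disjoint.\<close>

lemma lift_unique_on_connected:
  fixes f :: "'c::topological_space \<Rightarrow> 'b::topological_space"
    and g1 :: "'c \<Rightarrow> 'a::topological_space"
  assumes cov: "covering_space C p S" and K: "connected K"
    and g1: "continuous_on K g1" "g1 \<in> K \<rightarrow> C" "\<And>x. x \<in> K \<Longrightarrow> p (g1 x) = f x"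
    and g2: "continuous_on K g2" "g2 \<in> K \<rightarrow> C" "\<And>x. x \<in> K \<Longrightarrow> p (g2 x) = f x"
    and a: "a \<in> K" "g1 a = g2 a" and x: "x \<in> K"
  shows "g1 x = g2 x"
proof -
  define A where "A = {z \<in> K. g1 z = g2 z}"
  have same: "\<exists>T. openin (top_of_set K) T \<and> z \<in> T \<and> T \<subseteq> A" if z: "z \<in> A" for z
  proof -
    have zK: "z \<in> K" "g1 z = g2 z"
      using z by (auto simp: A_def)
    then have "g1 z \<in> C"
      using g1(2) by blast
    obtain v w q where v: "g1 z \<in> v" "openin (top_of_set C) v" "homeomorphism v w p q"
      using covering_space_local_homeomorphism [OF cov \<open>g1 z \<in> C\<close>] by metis
    let ?T = "(K \<inter> g1 -` v) \<inter> (K \<inter> g2 -` v)"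
    have "openin (top_of_set K) ?T"
      using continuous_openin_preimage [OF g1(1,2) v(2)] continuous_openin_preimage [OF g2(1,2) v(2)] by blast
    moreover have "?T \<subseteq> A"
      using v(3) g1(3) g2(3) unfolding A_def homeomorphism_def
      by (smt (verit) IntD1 IntD2 mem_Collect_eq subsetI vimage_eq)
    moreover have "z \<in> ?T"
      using zK v(1) by simp
    ultimately show ?thesis
      by blast
  qed
  have diff: "\<exists>T. openin (top_of_set K) T \<and> z \<in> T \<and> T \<subseteq> K - A" if z: "z \<in> K - A" for z
  proof -
    have zK: "z \<in> K" "g1 z \<noteq> g2 z" "g1 z \<in> C" "g2 z \<in> C"
      using z g1 g2 by (auto simp: A_def)
    have "f z \<in> S"
      using zK g1(3) covering_space_imp_surjective [OF cov] by force
    then obtain T \<V> where T: "f z \<in> T" "\<Union>\<V> = C \<inter> p -` T"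
      and op: "\<And>u. u \<in> \<V> \<Longrightarrow> openin (top_of_set C) u"
      and dj: "pairwise disjnt \<V>" and hom: "\<And>u. u \<in> \<V> \<Longrightarrow> \<exists>q. homeomorphism u T p q"
      using cov unfolding covering_space_def by meson
    obtain v1 v2 where v: "v1 \<in> \<V>" "g1 z \<in> v1" "v2 \<in> \<V>" "g2 z \<in> v2"
      using T zK g1(3) g2(3) by (metis Int_iff UnionE vimage_eq)
    have "v1 \<noteq> v2"
      using hom [OF v(1)] v zK g1(3) g2(3) unfolding homeomorphism_def by metis
    then have "v1 \<inter> v2 = {}"
      using dj v by (simp add: pairwise_def disjnt_def)
    let ?T = "(K \<inter> g1 -` v1) \<inter> (K \<inter> g2 -` v2)"
    have "openin (top_of_set K) ?T"
      using continuous_openin_preimage [OF g1(1,2) op [OF v(1)]] continuous_openin_preimage [OF g2(1,2) op [OF v(3)]]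
      by blast
    moreover have "?T \<subseteq> K - A"
      using \<open>v1 \<inter> v2 = {}\<close> by (auto simp: A_def)
    moreover have "z \<in> ?T"
      using zK v by simp
    ultimately show ?thesis
      by blast
  qed
  have "openin (top_of_set K) A" "openin (top_of_set K) (K - A)"
    using same diff by (meson openin_subopen)+
  then have "openin (top_of_set K) A \<and> closedin (top_of_set K) A"
    by (simp add: closedin_def A_def)
  then have "A = {} \<or> A = K"
    using K connected_clopen by blast
  then show ?thesis
    using a x by (auto simp: A_def)
qed

text \<open>A lift over \<open>{0..a} \<times> V\<close> extends across any point \<open>s\<close> of the unit interval, at the price of shrinking the neighbourhood \<open>V\<close> of
\<open>x1\<close>: near \<open>(s, x1)\<close> the homotopy stays in an evenly covered set, and the sheet through the value at \<open>(a, x1)\<close>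
prescribes the continuation. Compactness of the interval, in the form of the Bolzano principle, turns this into a lift over the
whole interval.\<close>

lemma covering_space_lift_homotopy_at:
  fixes h :: "real \<times> 'c::topological_space \<Rightarrow> 'b::topological_space"
    and p :: "'a::topological_space \<Rightarrow> 'b"
  assumes cov: "covering_space C p S"
    and h: "continuous_on ({0..1} \<times> U) h" "h \<in> {0..1} \<times> U \<rightarrow> S"
    and f: "continuous_on U f" "f \<in> U \<rightarrow> C" "\<And>x. x \<in> U \<Longrightarrow> h (0, x) = p (f x)"
    and x1: "x1 \<in> U"
  obtains V k where "openin (top_of_set U) V" "x1 \<in> V"
    "continuous_on ({0..1} \<times> V) k" "k \<in> {0..1} \<times> V \<rightarrow> C"
    "\<And>x. x \<in> V \<Longrightarrow> k (0, x) = f x" "\<And>z. z \<in> {0..1} \<times> V \<Longrightarrow> p (k z) = h z"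
proof -
  define L where "L b \<longleftrightarrow> (\<exists>V k. openin (top_of_set U) V \<and> x1 \<in> V \<and>
      continuous_on ({0..b} \<times> V) k \<and> k \<in> {0..b} \<times> V \<rightarrow> C \<and>
      (\<forall>x\<in>V. k (0, x) = f x) \<and> (\<forall>z\<in>{0..b} \<times> V. p (k z) = h z))" for b :: real
  have L0: "L 0"
    unfolding L_def
  proof (intro exI conjI)
    show "continuous_on ({0..0} \<times> U) (\<lambda>z. f (snd z))"
      by (rule continuous_on_compose2 [OF f(1)]) (auto intro: continuous_intros)
  qed (use f x1 in auto)
  have "0 \<le> (0::real) \<and> (1::real) \<le> 1 \<and> L 0 \<longrightarrow> L 1"
  proof (rule Bolzano [where P = "\<lambda>a b. 0 \<le> a \<and> b \<le> 1 \<and> L a \<longrightarrow> L b"])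
    fix s :: real
    assume local: "0 \<le> s" "s \<le> 1"
    have "h (s, x1) \<in> S"
      using h(2) x1 local by auto
    then obtain T \<V> where T: "h (s, x1) \<in> T" "openin (top_of_set S) T" "\<Union>\<V> = C \<inter> p -` T"
      and op: "\<And>u. u \<in> \<V> \<Longrightarrow> openin (top_of_set C) u"
      and hom: "\<And>u. u \<in> \<V> \<Longrightarrow> \<exists>q. homeomorphism u T p q"
      using cov unfolding covering_space_def by meson
    have "openin (top_of_set ({0..1} \<times> U)) (({0..1} \<times> U) \<inter> h -` T)"
      using h T(2) by (rule continuous_openin_preimage)
    then obtain W where W: "open W" "({0..1} \<times> U) \<inter> h -` T = ({0..1} \<times> U) \<inter> W"
      by (metis openin_open)
    have "(s, x1) \<in> W"
      using W T(1) local x1 by auto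
    then obtain I V where IV: "open I" "open V" "s \<in> I" "x1 \<in> V" "I \<times> V \<subseteq> W"
      using W(1) by (metis open_prod_elim mem_Sigma_iff)
    obtain d where d: "d > 0" "ball s d \<subseteq> I"
      using IV by (meson openE)
    have "L b" if ab: "a \<le> s" "s \<le> b" "b - a < d" "0 \<le> a" "b \<le> 1" and La: "L a" for a b
    proof -
      obtain V' k where V': "openin (top_of_set U) V'" "x1 \<in> V'"
        and k: "continuous_on ({0..a} \<times> V') k" "k \<in> {0..a} \<times> V' \<rightarrow> C"
          "\<And>x. x \<in> V' \<Longrightarrow> k (0, x) = f x" "\<And>z. z \<in> {0..a} \<times> V' \<Longrightarrow> p (k z) = h z"
        using La unfolding L_def by blast
      have V'U: "V' \<subseteq> U"
        using V'(1) openin_imp_subset by blast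
      have abI: "{a..b} \<subseteq> I"
        using ab d by (auto simp: dist_real_def subset_iff)
      have hT: "h (t, x) \<in> T" if "t \<in> {a..b}" "x \<in> V" "x \<in> U" for t x
      proof -
        have "(t, x) \<in> ({0..1} \<times> U) \<inter> W"
          using that abI IV(5) ab by auto
        then show ?thesis
          using W(2) by blast
      qed
      have "k (a, x1) \<in> C" "p (k (a, x1)) = h (a, x1)"
        using k V' ab by auto
      then have "k (a, x1) \<in> \<Union>\<V>"
        using hT [of a x1] ab IV x1 T(3) by auto
      then obtain v where v: "v \<in> \<V>" "k (a, x1) \<in> v"
        by blast
      obtain q where q: "homeomorphism v T p q"
        using hom v by blast
      have vC: "v \<subseteq> C"
        using op [OF v(1)] openin_imp_subset by blast
      define V2 where "V2 = V \<inter> (V' \<inter> (\<lambda>x. k (a, x)) -` v)"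
      have "continuous_on V' (\<lambda>x. k (a, x))"
        by (rule continuous_on_compose2 [OF k(1)]) (use ab in \<open>auto intro!: continuous_intros\<close>)
      moreover have "(\<lambda>x. k (a, x)) \<in> V' \<rightarrow> C"
        using k(2) ab by (force simp: Pi_iff)
      ultimately have "openin (top_of_set V') (V' \<inter> (\<lambda>x. k (a, x)) -` v)"
        using op [OF v(1)] by (rule continuous_openin_preimage)
      then have opV2: "openin (top_of_set U) V2"
        unfolding V2_def using V'(1) IV(2) by (metis inf.commute openin_Int_open openin_trans)
      have V2: "V2 \<subseteq> V" "V2 \<subseteq> V'" "V2 \<subseteq> U" "\<And>x. x \<in> V2 \<Longrightarrow> k (a, x) \<in> v"
        using V'U by (auto simp: V2_def)
      \<comment> \<open>beyond time \<open>a\<close> the lift is continued inside the sheet \<open>v\<close>, by the inverse \<open>q\<close> of \<open>p\<close> on it\<close>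
      define k' where "k' z = (if fst z \<le> a then k z else q (h z))" for z
      have ctq: "continuous_on ({a..b} \<times> V2) (\<lambda>z. q (h z))"
      proof (rule continuous_on_compose2 [where g = q and f = h])
        show "continuous_on T q" using q by (simp add: homeomorphism_def)
        show "continuous_on ({a..b} \<times> V2) h"
          by (rule continuous_on_subset [OF h(1)]) (use ab V2 in auto)
        show "h ` ({a..b} \<times> V2) \<subseteq> T"
          using hT V2(1,3) by blast
      qed
      have qk: "q (h (a, x)) = k (a, x)" if "x \<in> V2" for x
      proof -
        have "h (a, x) = p (k (a, x))"
          using k(4) [of "(a, x)"] that V2 ab by auto
        then show ?thesis
          using q V2(4) [OF that] by (simp add: homeomorphism_def)
      qed
      have "continuous_on ({0..a} \<times> V2 \<union> {a..b} \<times> V2) k'"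
        unfolding k'_def
      proof (rule continuous_on_cases_local)
        show "closedin (top_of_set ({0..a} \<times> V2 \<union> {a..b} \<times> V2)) ({0..a} \<times> V2)"
          unfolding closedin_closed
          by (rule exI [of _ "{..a} \<times> UNIV"]) (use ab in \<open>auto simp: closed_Times\<close>)
        show "closedin (top_of_set ({0..a} \<times> V2 \<union> {a..b} \<times> V2)) ({a..b} \<times> V2)"
          unfolding closedin_closed
          by (rule exI [of _ "{a..} \<times> UNIV"]) (use ab in \<open>auto simp: closed_Times\<close>)
        show "continuous_on ({0..a} \<times> V2) k"
          by (rule continuous_on_subset [OF k(1)]) (use V2 in auto)
        show "continuous_on ({a..b} \<times> V2) (\<lambda>z. q (h z))" by (fact ctq)
        show "k x = q (h x)" if "x \<in> {0..a} \<times> V2 \<and> \<not> fst x \<le> a \<or> x \<in> {a..b} \<times> V2 \<and> fst x \<le> a" for x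
          using that qk by (cases x) force
      qed
      moreover have "{0..a} \<times> V2 \<union> {a..b} \<times> V2 = {0..b} \<times> V2"
        using ab by auto
      ultimately have ctk': "continuous_on ({0..b} \<times> V2) k'"
        by simp
      have qT: "q y \<in> C" "p (q y) = y" if "y \<in> T" for y
        using q that vC by (auto simp: homeomorphism_def)
      have "k' z \<in> C \<and> p (k' z) = h z" if z: "z \<in> {0..b} \<times> V2" for z
      proof (cases "fst z \<le> a")
        case True
        then show ?thesis
          using z k(2,4) V2 by (cases z) (auto simp: k'_def)
      next
        case False
        then have "h z \<in> T"
          using z V2(1,3) hT [of "fst z" "snd z"] by (cases z) auto
        then show ?thesis
          using False qT by (simp add: k'_def)
      qed
      moreover have "x1 \<in> V2"
        using v(2) IV(4) V'(2) by (simp add: V2_def)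
      moreover have "k' (0, x) = f x" if "x \<in> V2" for x
        using k(3) V2(2) that ab by (auto simp: k'_def)
      ultimately show ?thesis
        unfolding L_def using opV2 ctk' by (metis (no_types, lifting) Pi_I)
    qed
    then show "\<exists>d>0. \<forall>a b. a \<le> s \<and> s \<le> b \<and> b - a < d \<longrightarrow> 0 \<le> a \<and> b \<le> 1 \<and> L a \<longrightarrow> L b"
      using d(1) by blast
  qed auto
  then have "L 1"
    using L0 by auto
  then show thesis
    unfolding L_def using that by (metis (no_types, lifting))
qed

text \<open>The local lifts agree on overlaps, by uniqueness along each segment \<open>{0..1} \<times> {x}\<close>, and so they glue.\<close>

lemma covering_space_lift_homotopy_general:
  fixes h :: "real \<times> 'c::topological_space \<Rightarrow> 'b::topological_space"
    and p :: "'a::topological_space \<Rightarrow> 'b"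
  assumes cov: "covering_space C p S"
    and h: "continuous_on ({0..1} \<times> U) h" "h \<in> {0..1} \<times> U \<rightarrow> S"
    and f: "continuous_on U f" "f \<in> U \<rightarrow> C" "\<And>x. x \<in> U \<Longrightarrow> h (0, x) = p (f x)"
  obtains k where "continuous_on ({0..1} \<times> U) k" "k \<in> {0..1} \<times> U \<rightarrow> C"
    "\<And>x. x \<in> U \<Longrightarrow> k (0, x) = f x" "\<And>z. z \<in> {0..1} \<times> U \<Longrightarrow> p (k z) = h z"
proof -
  define loc where "loc x V k \<longleftrightarrow> openin (top_of_set U) V \<and> x \<in> V \<and>
    continuous_on ({0..1} \<times> V) k \<and> k \<in> {0..1} \<times> V \<rightarrow> C \<and>
    (\<forall>x\<in>V. k (0, x) = f x) \<and> (\<forall>z\<in>{0..1} \<times> V. p (k z) = h z)"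
    for x :: 'c and V and k :: "real \<times> 'c \<Rightarrow> 'a"
  have "\<exists>V k. loc x V k" if "x \<in> U" for x
    using covering_space_lift_homotopy_at [OF cov h f that] unfolding loc_def by metis
  then obtain V k where Vk: "\<And>x. x \<in> U \<Longrightarrow> loc x (V x) (k x)"
    by metis
  have VU: "V x \<subseteq> U" if "x \<in> U" for x
    using Vk [OF that] openin_imp_subset unfolding loc_def by blast
  have slice: "continuous_on {0..1} (\<lambda>t. k x (t, y))" if "x \<in> U" "y \<in> V x" for x y
  proof (rule continuous_on_compose2 [where g = "k x" and f = "\<lambda>t. (t, y)"])
    show "continuous_on ({0..1} \<times> V x) (k x)"
      using Vk [OF that(1)] by (simp add: loc_def)
  qed (use that in \<open>auto intro!: continuous_intros\<close>)
  have agree: "k x (t, y) = k y (t, y)" if x: "x \<in> U" "y \<in> V x" and t: "t \<in> {0..1}" for x y t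
  proof -
    have y: "y \<in> U" "y \<in> V y"
      using VU x Vk unfolding loc_def by blast+
    show ?thesis
    proof (rule lift_unique_on_connected [OF cov, of "{0..1}" _ "\<lambda>t. h (t, y)" _ 0])
      show "k x (0, y) = k y (0, y)"
        using Vk [OF x(1)] Vk [OF y(1)] x y by (simp add: loc_def)
    qed (use Vk [OF x(1)] Vk [OF y(1)] x y t slice in \<open>auto simp: loc_def\<close>)
  qed
  define K where "K z = k (snd z) z" for z
  have Keq: "K z = k x z" if "x \<in> U" "z \<in> {0..1} \<times> V x" for x z
    using that agree by (cases z) (auto simp: K_def)
  show thesis
  proof
    show "continuous_on ({0..1} \<times> U) K"
    proof -
      have "continuous_map (top_of_set ({0..1} \<times> U)) euclidean K"
      proof (rule pasting_lemma [where T = "\<lambda>x. {0..1} \<times> V x" and f = k and I = U])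
        fix x assume x: "x \<in> U"
        show "openin (top_of_set ({0..1} \<times> U)) ({0..1} \<times> V x)"
          using Vk [OF x] by (simp add: loc_def openin_Times)
        have "({0..1::real} \<times> U) \<inter> ({0..1} \<times> V x) = {0..1} \<times> V x"
          using VU [OF x] by auto
        then show "continuous_map (subtopology (top_of_set ({0..1} \<times> U)) ({0..1} \<times> V x)) euclidean (k x)"
          using Vk [OF x] unfolding loc_def subtopology_subtopology by (simp only: continuous_map_iff_continuous)
      next
        fix x y z assume "x \<in> U" "y \<in> U"
          "z \<in> topspace (top_of_set ({0..1::real} \<times> U)) \<inter> {0..1} \<times> V x \<inter> {0..1} \<times> V y"
        then show "k x z = k y z"
          using Keq [of x z] Keq [of y z] by auto
      next
        fix z assume "z \<in> topspace (top_of_set ({0..1::real} \<times> U))"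
        then show "\<exists>x. x \<in> U \<and> z \<in> {0..1} \<times> V x \<and> K z = k x z"
          using Vk unfolding loc_def K_def by (cases z) auto
      qed
      then show ?thesis
        by simp
    qed
    show "K \<in> {0..1} \<times> U \<rightarrow> C"
    proof
      fix z assume "z \<in> {0..1::real} \<times> U"
      then show "K z \<in> C"
        using Vk [of "snd z"] by (cases z) (auto simp: K_def loc_def Pi_iff)
    qed
    show "K (0, x) = f x" if "x \<in> U" for x
      using Vk [OF that] by (simp add: K_def loc_def)
    show "p (K z) = h z" if "z \<in> {0..1::real} \<times> U" for z
      using Vk [of "snd z"] that by (cases z) (auto simp: K_def loc_def)
  qed
qed

text \<open>A homotopy from the constant map at \<open>z\<close> to the identity of \<open>K\<close> that keeps \<open>z\<close> fixed. Keeping \<open>z\<close> fixed is what makes the endpoint of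
the lifted homotopy take the prescribed value at \<open>z\<close>.\<close>

definition contraction :: "'c::topological_space set \<Rightarrow> 'c \<Rightarrow> (real \<times> 'c \<Rightarrow> 'c) \<Rightarrow> bool" where
  "contraction K z c \<longleftrightarrow> z \<in> K \<and> continuous_on ({0..1} \<times> K) c \<and> c \<in> {0..1} \<times> K \<rightarrow> K \<and>
     (\<forall>x\<in>K. c (0, x) = z \<and> c (1, x) = x) \<and> (\<forall>t\<in>{0..1}. c (t, z) = z)"

lemma contraction_path:
  assumes "contraction K z c" "x \<in> K"
  shows "continuous_on {0..1} (\<lambda>t. c (t, x))" "(\<lambda>t. c (t, x)) \<in> {0..1} \<rightarrow> K"
proof -
  have "continuous_on ({0..1} \<times> K) c"
    using assms by (simp add: contraction_def)
  then show "continuous_on {0..1} (\<lambda>t. c (t, x))"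
    by (rule continuous_on_compose2 [where g = c])
      (use assms in \<open>auto simp: contraction_def intro!: continuous_intros\<close>)
qed (use assms in \<open>auto simp: contraction_def\<close>)

lemma contraction_imp_connected:
  assumes c: "contraction K z c"
  shows "connected K"
proof -
  have "path_component K z x" if x: "x \<in> K" for x
    unfolding path_component_def
    by (rule exI [of _ "\<lambda>t. c (t, x)"])
      (use contraction_path [OF c x] c x in
        \<open>auto simp: path_def path_image_def pathstart_def pathfinish_def contraction_def\<close>)
  then have "path_connected K"
    by (meson path_component_sym path_component_trans path_connected_component)
  then show ?thesis
    by (rule path_connected_imp_connected)
qed

lemma unit_interval_contraction: "contraction {0..1::real} 0 (\<lambda>w. fst w * snd w)"
  by (auto simp: contraction_def mult_le_one intro!: continuous_intros)

text \<open>Composed with the contraction, \<open>F\<close> becomes a homotopy that starts at a constant map, and a constant map has a lift.\<close>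

lemma covering_space_lift_from_centre:
  fixes F :: "'c::topological_space \<Rightarrow> 'b::topological_space"
    and p :: "'a::topological_space \<Rightarrow> 'b"
  assumes cov: "covering_space C p S" and c: "contraction K z c"
    and F: "continuous_on K F" "F \<in> K \<rightarrow> S" and y: "y \<in> C" "p y = F z"
  obtains g where "continuous_on K g" "g \<in> K \<rightarrow> C" "\<And>x. x \<in> K \<Longrightarrow> p (g x) = F x" "g z = y"
proof -
  have c': "z \<in> K" "continuous_on ({0..1} \<times> K) c" "c \<in> {0..1} \<times> K \<rightarrow> K"
    "\<And>x. x \<in> K \<Longrightarrow> c (0, x) = z" "\<And>x. x \<in> K \<Longrightarrow> c (1, x) = x"
    using c by (auto simp: contraction_def)
  have "continuous_on ({0..1} \<times> K) (\<lambda>w. F (c w))"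
    by (rule continuous_on_compose2 [OF F(1) c'(2)]) (use c'(3) in auto)
  moreover have "(\<lambda>w. F (c w)) \<in> {0..1} \<times> K \<rightarrow> S"
    using c'(3) F(2) by blast
  moreover have "continuous_on K (\<lambda>x. y)" "(\<lambda>x. y) \<in> K \<rightarrow> C"
    using y by auto
  moreover have "F (c (0, x)) = p y" if "x \<in> K" for x
    using that c'(4) y by simp
  ultimately obtain k where k: "continuous_on ({0..1} \<times> K) k" "k \<in> {0..1} \<times> K \<rightarrow> C"
    "\<And>x. x \<in> K \<Longrightarrow> k (0, x) = y" "\<And>w. w \<in> {0..1} \<times> K \<Longrightarrow> p (k w) = F (c w)"
    using covering_space_lift_homotopy_general [OF cov, of K "\<lambda>w. F (c w)" "\<lambda>x. y"] by blast
  show thesis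
  proof
    show "continuous_on K (\<lambda>x. k (1, x))"
      by (rule continuous_on_compose2 [OF k(1)]) (auto intro!: continuous_intros)
    show "(\<lambda>x. k (1, x)) \<in> K \<rightarrow> C"
      using k(2) by auto
    show "p (k (1, x)) = F x" if "x \<in> K" for x
      using k(4) that c'(5) by simp
    have "k (1, z) = (\<lambda>t. y) (1::real)"
    proof (rule lift_unique_on_connected [OF cov, of "{0..1}" "\<lambda>t. k (t, z)" "\<lambda>t. F (c (t, z))" _ 0])
      show "continuous_on {0..1} (\<lambda>t. k (t, z))"
        by (rule continuous_on_compose2 [OF k(1)]) (use c'(1) in \<open>auto intro!: continuous_intros\<close>)
      show "(\<lambda>t. k (t, z)) \<in> {0..1} \<rightarrow> C"
        using k(2) c'(1) by auto
      fix t :: real assume t: "t \<in> {0..1}"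
      show "p (k (t, z)) = F (c (t, z))"
        using k(4) c'(1) t by simp
      show "p y = F (c (t, z))"
        using c t y by (simp add: contraction_def)
    qed (use y k(3) c'(1) in auto)
    then show "k (1, z) = y" by simp
  qed
qed


text \<open>A value prescribed at an arbitrary point \<open>x\<close> is first transported to the centre along the path which the contraction
provides.\<close>

lemma covering_space_lift_contractible:
  fixes F :: "'c::topological_space \<Rightarrow> 'b::topological_space"
    and p :: "'a::topological_space \<Rightarrow> 'b"
  assumes cov: "covering_space C p S" and c: "contraction K z c"
    and F: "continuous_on K F" "F \<in> K \<rightarrow> S" and x: "x \<in> K" and y: "y \<in> C" "p y = F x"
  obtains g where "continuous_on K g" "g \<in> K \<rightarrow> C" "\<And>x. x \<in> K \<Longrightarrow> p (g x) = F x" "g x = y"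
proof -
  \<comment> \<open>the image under \<open>F\<close> of the path from \<open>x\<close> to the centre\<close>
  define \<gamma> where "\<gamma> t = F (c (1 - t, x))" for t :: real
  have flip: "continuous_on {0..1} (\<lambda>t. 1 - t :: real)" "(\<lambda>t. 1 - t) ` {0..1} \<subseteq> {0..1::real}"
    by (auto intro!: continuous_intros)
  have \<gamma>: "continuous_on {0..1} \<gamma>" "\<gamma> \<in> {0..1} \<rightarrow> S"
    unfolding \<gamma>_def
    using continuous_on_compose2 [OF contraction_path(1) [OF c x] flip]
      contraction_path(2) [OF c x] F
    by (auto intro!: continuous_on_compose2 [OF F(1)])
  have "p y = \<gamma> 0"
    using c x y by (simp add: \<gamma>_def contraction_def)
  then obtain \<eta> where \<eta>: "continuous_on {0..1} \<eta>" "\<eta> \<in> {0..1} \<rightarrow> C"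
    "\<And>t. t \<in> {0..1} \<Longrightarrow> p (\<eta> t) = \<gamma> t" "\<eta> 0 = y"
    using covering_space_lift_from_centre [OF cov unit_interval_contraction \<gamma> y(1)] by metis
  have "\<eta> 1 \<in> C" "p (\<eta> 1) = F z"
    using \<eta> c x by (auto simp: \<gamma>_def contraction_def)
  then obtain g where g: "continuous_on K g" "g \<in> K \<rightarrow> C" "\<And>x. x \<in> K \<Longrightarrow> p (g x) = F x" "g z = \<eta> 1"
    using covering_space_lift_from_centre [OF cov c F] by metis
  have "g (c (1 - 0, x)) = \<eta> 0"
  proof (rule lift_unique_on_connected [OF cov, of "{0..1}" "\<lambda>t. g (c (1 - t, x))" \<gamma> \<eta> 1])
    show "continuous_on {0..1} (\<lambda>t. g (c (1 - t, x)))"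
      using continuous_on_compose2 [OF contraction_path(1) [OF c x] flip]
        contraction_path(2) [OF c x]
      by (auto intro!: continuous_on_compose2 [OF g(1)])
    show "(\<lambda>t. g (c (1 - t, x))) \<in> {0..1} \<rightarrow> C"
      using contraction_path(2) [OF c x] g(2) by auto
    show "p (g (c (1 - t, x))) = \<gamma> t" if "t \<in> {0..1}" for t
      using Pi_mem [OF contraction_path(2) [OF c x], of "1 - t"] g(3) that by (simp add: \<gamma>_def)
    show "g (c (1 - 1, x)) = \<eta> 1"
      using c x g(4) by (simp add: contraction_def)
  qed (use \<eta> in auto)
  then have "g x = y"
    using c x \<eta>(4) by (simp add: contraction_def)
  with g(1-3) show thesis
    by (rule that)
qed



section \<open>Transport of points along paths\<close>

text \<open>Path lifting as a relation between points. For a covering it is the graph of a bijection between the fibres over the two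
endpoints of \<open>\<gamma>\<close>.\<close>

definition transports :: "'a::topological_space set \<Rightarrow> ('a \<Rightarrow> 'b::topological_space) \<Rightarrow> (real \<Rightarrow> 'b) \<Rightarrow> 'a \<Rightarrow> 'a \<Rightarrow> bool" where
  "transports C p \<gamma> y y' \<longleftrightarrow> (\<exists>\<eta>. path \<eta> \<and> path_image \<eta> \<subseteq> C \<and> (\<forall>t\<in>{0..1}. p (\<eta> t) = \<gamma> t) \<and>
     pathstart \<eta> = y \<and> pathfinish \<eta> = y')"

lemma transports_exists:
  assumes "covering_space C p S" "path \<gamma>" "path_image \<gamma> \<subseteq> S" "y \<in> C" "p y = pathstart \<gamma>"
  obtains y' where "transports C p \<gamma> y y'"
proof -
  obtain \<eta> where "continuous_on {0..1} \<eta>" "\<eta> \<in> {0..1} \<rightarrow> C"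
    "\<And>t. t \<in> {0..1} \<Longrightarrow> p (\<eta> t) = \<gamma> t" "\<eta> 0 = y"
    using covering_space_lift_from_centre [OF assms(1) unit_interval_contraction, of \<gamma> y] assms
    by (auto simp: path_def path_image_def pathstart_def)
  then show thesis
    by (intro that [of "\<eta> 1"])
      (auto simp: transports_def path_def path_image_def pathstart_def pathfinish_def intro!: exI [of _ \<eta>])
qed

lemma transports_ends:
  assumes "transports C p \<gamma> y y'"
  shows "y \<in> C" "y' \<in> C" "p y = pathstart \<gamma>" "p y' = pathfinish \<gamma>"
  using assms unfolding transports_def
  by (auto simp: path_image_def pathstart_def pathfinish_def)

lemma transports_unique:
  assumes cov: "covering_space C p S" and "transports C p \<gamma> y y1" "transports C p \<gamma> y y2"
  shows "y1 = y2"
proof -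
  obtain \<eta>1 \<eta>2 where "path \<eta>1" "path_image \<eta>1 \<subseteq> C" "\<And>t. t \<in> {0..1} \<Longrightarrow> p (\<eta>1 t) = \<gamma> t"
    "\<eta>1 0 = y" "\<eta>1 1 = y1" "path \<eta>2" "path_image \<eta>2 \<subseteq> C" "\<And>t. t \<in> {0..1} \<Longrightarrow> p (\<eta>2 t) = \<gamma> t"
    "\<eta>2 0 = y" "\<eta>2 1 = y2"
    using assms by (auto simp: transports_def pathstart_def pathfinish_def)
  then have "\<eta>1 1 = \<eta>2 1"
    by (intro lift_unique_on_connected [OF cov, of "{0..1}" \<eta>1 \<gamma> \<eta>2 0 1])
      (auto simp: path_def path_image_def)
  then show ?thesis
    using \<open>\<eta>1 1 = y1\<close> \<open>\<eta>2 1 = y2\<close> by simp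
qed

lemma transports_reverse:
  assumes "transports C p \<gamma> y y'"
  shows "transports C p (reversepath \<gamma>) y' y"
proof -
  obtain \<eta> where "path \<eta>" "path_image \<eta> \<subseteq> C" "\<And>t. t \<in> {0..1} \<Longrightarrow> p (\<eta> t) = \<gamma> t"
    "pathstart \<eta> = y" "pathfinish \<eta> = y'"
    using assms by (auto simp: transports_def)
  moreover have "reversepath h t = h (1 - t)" for h :: "real \<Rightarrow> 'a" and t
    by (simp add: reversepath_def)
  ultimately show ?thesis
    unfolding transports_def by (intro exI [of _ "reversepath \<eta>"]) (auto simp: reversepath_def [of \<gamma>])
qed

lemma transports_inj:
  assumes "covering_space C p S" "transports C p \<gamma> y1 y" "transports C p \<gamma> y2 y"
  shows "y1 = y2"
  using transports_unique [OF assms(1)] transports_reverse assms(2,3) by metis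

lemma transports_join:
  assumes "transports C p \<gamma> y y'" "transports C p \<delta> y' y''"
  shows "transports C p (\<gamma> +++ \<delta>) y y''"
proof -
  obtain \<eta> \<theta> where *: "path \<eta>" "path_image \<eta> \<subseteq> C" "\<And>t. t \<in> {0..1} \<Longrightarrow> p (\<eta> t) = \<gamma> t"
    "pathstart \<eta> = y" "pathfinish \<eta> = y'"
    "path \<theta>" "path_image \<theta> \<subseteq> C" "\<And>t. t \<in> {0..1} \<Longrightarrow> p (\<theta> t) = \<delta> t"
    "pathstart \<theta> = y'" "pathfinish \<theta> = y''"
    using assms by (auto simp: transports_def)
  have "p ((\<eta> +++ \<theta>) t) = (\<gamma> +++ \<delta>) t" if "t \<in> {0..1}" for t
    using that *(3) [of "2 * t"] *(8) [of "2 * t - 1"] by (simp add: joinpaths_def)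
  then show ?thesis
    unfolding transports_def using *
    by (intro exI [of _ "\<eta> +++ \<theta>"]) (auto simp: path_image_join)
qed

section \<open>Groups exhausted by the kernels of a surjective endomorphism\<close>

lemma hom_eq_on_generate:
  assumes G: "group G" and Q: "group Q" and \<kappa>: "\<kappa> \<in> hom G Q" "\<kappa>' \<in> hom G Q"
    and B: "B \<subseteq> carrier G" "\<And>b. b \<in> B \<Longrightarrow> \<kappa> b = \<kappa>' b" and g: "g \<in> generate G B"
  shows "\<kappa> g = \<kappa>' g"
proof -
  interpret G: group G by (fact G)
  interpret k: group_hom G Q \<kappa> using G Q \<kappa> by (simp add: group_hom_def group_hom_axioms_def)
  interpret k': group_hom G Q \<kappa>' using G Q \<kappa> by (simp add: group_hom_def group_hom_axioms_def)
  from g show ?thesis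
  proof (induction rule: generate.induct)
    case (eng h1 h2)
    then show ?case
      using G.generate_in_carrier [OF B(1)] by simp
  qed (use B in auto)
qed

text \<open>The generating set may depend on the finite set that it has to reach, but its size may not.
The Pruefer groups satisfy this with \<open>r = 1\<close> without being finitely generated.\<close>

definition uniformly_generated :: "('a, 'b) monoid_scheme \<Rightarrow> nat \<Rightarrow> bool" where
  "uniformly_generated G r \<longleftrightarrow> (\<forall>A \<subseteq> carrier G. finite A \<longrightarrow>
     (\<exists>B \<subseteq> carrier G. finite B \<and> card B \<le> r \<and> A \<subseteq> generate G B))"

text \<open>Finitely many homomorphisms are told apart by finitely many elements, hence by their values on at most \<open>r\<close> generators. So there are no
more than \<open>card (carrier Q) ^ r\<close> of them.\<close>

lemma finite_homs_to_finite_group: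
  assumes G: "group G" and Q: "group Q" and fin: "finite (carrier Q)"
    and r: "uniformly_generated G r"
  shows "finite (hom G Q \<inter> extensional (carrier G))" (is "finite ?H")
proof (rule ccontr)
  assume "infinite ?H"
  then obtain M where M: "finite M" "card M = Suc (card (carrier Q) ^ r)" "M \<subseteq> ?H"
    using infinite_arbitrarily_large by blast
  have "\<exists>a \<in> carrier G. \<kappa> a \<noteq> \<kappa>' a" if "\<kappa> \<in> M" "\<kappa>' \<in> M" "\<kappa> \<noteq> \<kappa>'" for \<kappa> \<kappa>'
  proof (rule ccontr)
    assume "\<not> (\<exists>a \<in> carrier G. \<kappa> a \<noteq> \<kappa>' a)"
    then have "\<kappa> = \<kappa>'"
      using that M(3) by (intro extensionalityI [of \<kappa> "carrier G"]) auto
    with that(3) show False ..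
  qed
  then obtain a where a: "\<And>\<kappa> \<kappa>'. \<kappa> \<in> M \<Longrightarrow> \<kappa>' \<in> M \<Longrightarrow> \<kappa> \<noteq> \<kappa>' \<Longrightarrow>
      a \<kappa> \<kappa>' \<in> carrier G \<and> \<kappa> (a \<kappa> \<kappa>') \<noteq> \<kappa>' (a \<kappa> \<kappa>')"
    by metis
  \<comment> \<open>one element for each pair of homomorphisms in \<open>M\<close>, at which they differ\<close>
  define A where "A = (\<lambda>(\<kappa>, \<kappa>'). a \<kappa> \<kappa>') ` {(\<kappa>, \<kappa>') \<in> M \<times> M. \<kappa> \<noteq> \<kappa>'}"
  have "finite A" "A \<subseteq> carrier G"
    using a M(1) by (auto simp: A_def intro!: finite_imageI intro: finite_subset [of _ "M \<times> M"])
  then obtain B where B: "B \<subseteq> carrier G" "finite B" "card B \<le> r" "A \<subseteq> generate G B"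
    using r unfolding uniformly_generated_def by meson
  have "inj_on (\<lambda>\<kappa>. restrict \<kappa> B) M"
  proof (rule inj_onI, rule ccontr)
    fix \<kappa> \<kappa>' assume k: "\<kappa> \<in> M" "\<kappa>' \<in> M" "restrict \<kappa> B = restrict \<kappa>' B" "\<kappa> \<noteq> \<kappa>'"
    then have "a \<kappa> \<kappa>' \<in> generate G B"
      using B(4) by (auto simp: A_def)
    moreover have "\<kappa> b = \<kappa>' b" if "b \<in> B" for b
      using k(3) that by (metis restrict_apply')
    ultimately have "\<kappa> (a \<kappa> \<kappa>') = \<kappa>' (a \<kappa> \<kappa>')"
      using hom_eq_on_generate [OF G Q _ _ B(1)] k M(3) by blast
    then show False
      using a k by blast
  qed
  moreover have "(\<lambda>\<kappa>. restrict \<kappa> B) ` M \<subseteq> (\<Pi>\<^sub>E b\<in>B. carrier Q)"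
    using M(3) B(1) by (fastforce simp: hom_def)
  moreover have "finite (\<Pi>\<^sub>E b\<in>B. carrier Q)"
    using B fin by (simp add: finite_PiE)
  ultimately have "card M \<le> card (\<Pi>\<^sub>E b\<in>B. carrier Q)"
    by (metis card_inj_on_le)
  also have "\<dots> = card (carrier Q) ^ card B"
    using B by (simp add: card_PiE)
  also have "\<dots> \<le> card (carrier Q) ^ r"
  proof (rule power_increasing [OF B(3)])
    have "carrier Q \<noteq> {}"
      using Q group.is_monoid monoid.one_closed by blast
    then show "1 \<le> card (carrier Q)"
      using fin by (simp add: Suc_le_eq card_gt_0_iff)
  qed
  finally show False
    using M(2) by simp
qed

text \<open>Precomposition with the surjection \<open>\<Phi>\<close> is injective on the finite set of homomorphisms to \<open>Q\<close>, hence onto: every homomorphism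
factors through \<open>\<Phi>\<close>, and by iteration through \<open>\<Phi> ^^ j\<close>, which kills \<open>g\<close>.\<close>

lemma no_finite_quotient:
  assumes G: "group G" and Q: "group Q" and fin: "finite (carrier Q)"
    and r: "uniformly_generated G r"
    and \<Phi>: "\<Phi> \<in> hom G G" "\<Phi> ` carrier G = carrier G"
    and nil: "g \<in> carrier G" "(\<Phi> ^^ j) g = \<one>\<^bsub>G\<^esub>"
    and \<kappa>: "\<kappa> \<in> hom G Q"
  shows "\<kappa> g = \<one>\<^bsub>Q\<^esub>"
proof -
  interpret G: group G by (fact G)
  define H where "H = hom G Q \<inter> extensional (carrier G)"
  define c where "c \<kappa> = restrict (\<kappa> \<circ> \<Phi>) (carrier G)" for \<kappa> :: "'a \<Rightarrow> 'c"
  have \<Phi>in: "\<Phi> x \<in> carrier G" if "x \<in> carrier G" for x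
    using that \<Phi> by blast
  have "finite H"
    unfolding H_def by (rule finite_homs_to_finite_group [OF G Q fin r])
  moreover have "c ` H \<subseteq> H"
  proof
    fix \<kappa>' assume "\<kappa>' \<in> c ` H"
    then obtain \<kappa> where k: "\<kappa> \<in> hom G Q" "\<kappa>' = c \<kappa>"
      by (auto simp: H_def)
    have "\<kappa> \<circ> \<Phi> \<in> hom G Q"
      using \<Phi>(1) k(1) by (rule hom_compose)
    then have "\<kappa>' \<in> hom G Q"
      by (simp add: k(2) c_def hom_def Pi_iff)
    then show "\<kappa>' \<in> H"
      by (simp add: H_def k(2) c_def)
  qed
  moreover have "inj_on c H"
  proof (rule inj_onI)
    fix \<kappa> \<kappa>' assume k: "\<kappa> \<in> H" "\<kappa>' \<in> H" "c \<kappa> = c \<kappa>'"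
    have "\<kappa> x = \<kappa>' x" if "x \<in> carrier G" for x
    proof -
      obtain y where y: "y \<in> carrier G" "x = \<Phi> y"
        using \<Phi>(2) \<open>x \<in> carrier G\<close> by blast
      then show ?thesis
        using fun_cong [OF k(3), of y] by (simp add: c_def)
    qed
    then show "\<kappa> = \<kappa>'"
      using k by (auto simp: H_def intro: extensionalityI)
  qed
  ultimately have onto: "c ` H = H"
    by (simp add: endo_inj_surj)
  have "\<exists>\<kappa>' \<in> H. \<forall>x \<in> carrier G. \<kappa> x = \<kappa>' ((\<Phi> ^^ i) x)" if "\<kappa> \<in> H" for \<kappa> i
  proof (induction i)
    case (Suc i)
    then obtain \<kappa>' where k': "\<kappa>' \<in> H" "\<And>x. x \<in> carrier G \<Longrightarrow> \<kappa> x = \<kappa>' ((\<Phi> ^^ i) x)"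
      by blast
    then obtain \<kappa>'' where k'': "\<kappa>'' \<in> H" "\<kappa>' = c \<kappa>''"
      using onto by blast
    have "(\<Phi> ^^ i) x \<in> carrier G" if "x \<in> carrier G" for x
      using that \<Phi>in by (induction i) auto
    then show ?case
      using k' k'' by (auto simp: c_def)
  qed (use that in auto)
  moreover have "restrict \<kappa> (carrier G) \<in> H"
    using \<kappa> by (simp add: H_def hom_def Pi_iff)
  ultimately obtain \<kappa>' where k': "\<kappa>' \<in> H" "\<kappa> g = \<kappa>' ((\<Phi> ^^ j) g)"
    using nil(1) by (metis restrict_apply')
  then have "\<kappa> g = \<kappa>' \<one>\<^bsub>G\<^esub>"
    using nil(2) by simp
  also have "\<dots> = \<one>\<^bsub>Q\<^esub>"
    using k'(1) G Q hom_one by (metis H_def IntD1)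
  finally show ?thesis .
qed

text \<open>The kernel of an iterate of \<open>\<Phi>\<close> is a finite normal subgroup, and conjugation maps the group to its finite group of
permutations. That homomorphism is trivial, so the kernel is central; the kernels exhaust the group.\<close>

theorem uniformly_generated_imp_comm_group:
  assumes G: "group G" and r: "uniformly_generated G r"
    and \<Phi>: "\<Phi> \<in> hom G G" "\<Phi> ` carrier G = carrier G"
    and nil: "\<And>g. g \<in> carrier G \<Longrightarrow> \<exists>j. (\<Phi> ^^ j) g = \<one>\<^bsub>G\<^esub>"
    and fin: "\<And>j. finite {g \<in> carrier G. (\<Phi> ^^ j) g = \<one>\<^bsub>G\<^esub>}"
  shows "comm_group G"
proof -
  interpret G: group G by (fact G)
  have "g \<otimes>\<^bsub>G\<^esub> a = a \<otimes>\<^bsub>G\<^esub> g" if g: "g \<in> carrier G" and a: "a \<in> carrier G" for g a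
  proof -
    obtain j where j: "(\<Phi> ^^ j) a = \<one>\<^bsub>G\<^esub>"
      using nil [OF a] by blast
    define N where "N = {g \<in> carrier G. (\<Phi> ^^ j) g = \<one>\<^bsub>G\<^esub>}"
    have "(\<Phi> ^^ j) \<in> hom G G"
    proof (induction j)
      case (Suc j)
      then show ?case
        using hom_compose [OF Suc.IH \<Phi>(1)] by (simp add: o_def)
    qed (simp add: hom_def)
    then interpret \<Phi>j: group_hom G G "\<Phi> ^^ j"
      by (simp add: group_hom_def group_hom_axioms_def G)
    define \<kappa> where "\<kappa> x = (\<lambda>n\<in>N. x \<otimes>\<^bsub>G\<^esub> n \<otimes>\<^bsub>G\<^esub> inv\<^bsub>G\<^esub> x)" for x
    have N: "N \<subseteq> carrier G" by (auto simp: N_def)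
    have conj: "x \<otimes>\<^bsub>G\<^esub> n \<otimes>\<^bsub>G\<^esub> inv\<^bsub>G\<^esub> x \<in> N" if "x \<in> carrier G" "n \<in> N" for x n
      using that by (simp add: N_def)
    have comp: "\<kappa> (x \<otimes>\<^bsub>G\<^esub> y) n = \<kappa> x (\<kappa> y n)" if "x \<in> carrier G" "y \<in> carrier G" "n \<in> N" for x y n
      using that conj N by (simp add: \<kappa>_def G.m_assoc G.inv_mult_group subset_iff)
    have one: "\<kappa> \<one>\<^bsub>G\<^esub> n = n" if "n \<in> N" for n
      using that N by (auto simp: \<kappa>_def)
    have \<kappa>N: "\<kappa> x n \<in> N" if "x \<in> carrier G" "n \<in> N" for x n
      using that conj by (simp add: \<kappa>_def)
    have bij: "\<kappa> x \<in> Bij N" if x: "x \<in> carrier G" for x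
    proof -
      have "\<kappa> (inv\<^bsub>G\<^esub> x) (\<kappa> x n) = n" "\<kappa> x (\<kappa> (inv\<^bsub>G\<^esub> x) n) = n" if "n \<in> N" for n
        using comp [of "inv\<^bsub>G\<^esub> x" x n] comp [of x "inv\<^bsub>G\<^esub> x" n] x that one by auto
      then have "bij_betw (\<kappa> x) N N"
        using \<kappa>N x by (intro bij_betw_byWitness [where f' = "\<kappa> (inv\<^bsub>G\<^esub> x)"]) auto
      then show ?thesis
        by (simp add: Bij_def \<kappa>_def)
    qed
    have hom: "\<kappa> \<in> hom G (BijGroup N)"
    proof (rule homI)
      fix x y assume xy: "x \<in> carrier G" "y \<in> carrier G"
      have "\<kappa> (x \<otimes>\<^bsub>G\<^esub> y) = compose N (\<kappa> x) (\<kappa> y)"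
      proof (rule extensionalityI [of _ N])
        show "\<kappa> (x \<otimes>\<^bsub>G\<^esub> y) n = compose N (\<kappa> x) (\<kappa> y) n" if "n \<in> N" for n
          using comp xy that by (simp add: compose_eq)
      qed (auto simp: \<kappa>_def compose_def)
      then show "\<kappa> (x \<otimes>\<^bsub>G\<^esub> y) = \<kappa> x \<otimes>\<^bsub>BijGroup N\<^esub> \<kappa> y"
        using bij xy by (simp add: BijGroup_def)
    qed (use bij in \<open>simp add: BijGroup_def\<close>)
    have "finite N"
      using fin by (simp add: N_def)
    then have "finite (carrier (BijGroup N))"
      by (auto simp: BijGroup_def Bij_def bij_betw_def PiE_def extensional_def
          intro!: finite_subset [OF _ finite_PiE [of N "\<lambda>_. N"]])
    moreover obtain i where "(\<Phi> ^^ i) g = \<one>\<^bsub>G\<^esub>"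
      using nil [OF g] by blast
    ultimately have "\<kappa> g = \<one>\<^bsub>BijGroup N\<^esub>"
      using no_finite_quotient [OF G group_BijGroup _ r \<Phi> g _ hom] by blast
    moreover have "a \<in> N"
      using a j by (simp add: N_def)
    ultimately have "\<kappa> g a = a"
      by (simp add: BijGroup_def)
    with \<open>a \<in> N\<close> have "g \<otimes>\<^bsub>G\<^esub> a \<otimes>\<^bsub>G\<^esub> inv\<^bsub>G\<^esub> g = a"
      by (simp add: \<kappa>_def)
    then show ?thesis
      using a g by (metis G.inv_closed G.inv_solve_right' G.m_closed)
  qed
  then show ?thesis
    by (intro G.group_comm_groupI)
qed

section \<open>Discs and spheres\<close>

lemma subtopology_Euclidean_space:
  "D \<subseteq> topspace (Euclidean_space n) \<Longrightarrow> subtopology (Euclidean_space n) D = top_of_set D"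
  by (simp add: Euclidean_space_def euclidean_product_topology subtopology_subtopology Int_absorb1)

lemma closed_disc_eq: "closed_disc n = open_disc n \<union> boundary_sphere n"
  by (auto simp: closed_disc_def open_disc_def boundary_sphere_def)

lemma disc_subsets:
  "closed_disc n \<subseteq> topspace (Euclidean_space n)" "open_disc n \<subseteq> topspace (Euclidean_space n)"
  by (auto simp: closed_disc_def open_disc_def)

lemma closed_disc_contraction: "contraction (closed_disc n) (\<lambda>i. 0) (\<lambda>w i. fst w * snd w i)"
proof -
  have "(\<Sum>i<n. (t * x i)\<^sup>2) \<le> 1" if "0 \<le> t" "t \<le> 1" "(\<Sum>i<n. (x i)\<^sup>2) \<le> 1" for t :: real and x :: "nat \<Rightarrow> real"
  proof -
    have "(\<Sum>i<n. (t * x i)\<^sup>2) = t\<^sup>2 * (\<Sum>i<n. (x i)\<^sup>2)"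
      by (simp add: power_mult_distrib sum_distrib_left)
    also have "\<dots> \<le> 1"
      using that by (intro mult_le_one) (auto simp: power_le_one sum_nonneg)
    finally show ?thesis .
  qed
  moreover have "continuous_on ({0..1} \<times> closed_disc n) (\<lambda>w i. fst w * snd w i :: real)"
    by (intro continuous_on_coordinatewise_then_product continuous_intros
        continuous_on_product_then_coordinatewise [OF continuous_on_snd])
  ultimately show ?thesis
    by (auto simp: contraction_def closed_disc_def topspace_Euclidean_space)
qed

lemma compact_closed_disc: "compact (closed_disc n)"
proof -
  have "compactin (powertop_real UNIV) (UNIV \<rightarrow>\<^sub>E {-1..1})"
    by (simp add: compactin_PiE)
  moreover have "closed_disc n \<subseteq> UNIV \<rightarrow>\<^sub>E {-1..1}"
  proof -
    have "\<bar>x i\<bar> \<le> 1" if "x \<in> closed_disc n" for x i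
    proof (cases "i < n")
      case True
      then have "(x i)\<^sup>2 \<le> (\<Sum>i<n. (x i)\<^sup>2)"
        by (intro member_le_sum) auto
      also have "\<dots> \<le> 1"
        using that by (simp add: closed_disc_def)
      finally show ?thesis
        by (simp add: abs_square_le_1)
    qed (use that in \<open>auto simp: closed_disc_def topspace_Euclidean_space\<close>)
    then show ?thesis
      by (auto simp: abs_le_iff) 
  qed
  moreover have "closed (closed_disc n)"
  proof -
    have "closed_disc n = (\<Inter>i\<in>{n..}. {x. x i = 0}) \<inter> {x. (\<Sum>i<n. (x i)\<^sup>2) \<le> 1}"
      by (auto simp: closed_disc_def topspace_Euclidean_space)
    moreover have "closed {x :: nat \<Rightarrow> real. x i = 0}" for i
      by (intro closed_Collect_eq continuous_intros continuous_on_product_coordinates)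
    moreover have "closed {x :: nat \<Rightarrow> real. (\<Sum>i<n. (x i)\<^sup>2) \<le> 1}"
      by (intro closed_Collect_le continuous_intros continuous_on_product_coordinates)
    ultimately show ?thesis
      by (simp add: closed_INT closed_Int)
  qed
  ultimately show ?thesis
    using closed_compactin [of "powertop_real UNIV" _ "closed_disc n"]
    by (simp add: euclidean_product_topology)
qed

text \<open>The sphere is the union of two contractible hemispheres, which meet as soon as there is a second coordinate.\<close>

lemma connected_boundary_sphere:
  assumes "n \<ge> 2"
  shows "connected (boundary_sphere n)"
proof -
  define m where "m = n - 1"
  have m: "n = Suc m" "m \<ge> 1"
    using assms by (auto simp: m_def)
  have top: "nsphere m = top_of_set (boundary_sphere n)"
    by (simp add: nsphere m boundary_sphere_def topspace_Euclidean_space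
        euclidean_product_topology lessThan_Suc_atMost Suc_le_eq)
       (metis (mono_tags, lifting) Collect_conj_eq)
  define U where "U = boundary_sphere n \<inter> {x. x 0 \<ge> 0}"
  define V where "V = boundary_sphere n \<inter> {x. x 0 \<le> 0}"
  have "connected U" "connected V"
    using contractible_imp_connected_space [OF contractible_space_upper_hemisphere [of 0 m]]
      contractible_imp_connected_space [OF contractible_space_lower_hemisphere [of 0 m]]
    by (auto simp: top subtopology_subtopology U_def V_def connectedin_def simp flip: connectedin_iff_connected)
  moreover have "(\<lambda>i. if i = 1 then 1 else 0) \<in> U \<inter> V"
    using m by (auto simp: U_def V_def boundary_sphere_def topspace_Euclidean_space
        if_distrib [where f = "\<lambda>x. x ^ 2"] cong: if_cong)
  ultimately have "connected (U \<union> V)"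
    by (intro connected_Un) auto
  moreover have "U \<union> V = boundary_sphere n"
    by (auto simp: U_def V_def)
  ultimately show ?thesis
    by simp
qed

lemma disc_dim0: "closed_disc 0 = {\<lambda>i. 0}" "open_disc 0 = {\<lambda>i. 0}" "boundary_sphere 0 = {}"
  by (auto simp: closed_disc_def open_disc_def boundary_sphere_def topspace_Euclidean_space)

text \<open>The points of the line that carries the 1-dimensional disc; its endpoints are the values at \<open>-1\<close> and \<open>1\<close>.\<close>

definition segment_point :: "real \<Rightarrow> nat \<Rightarrow> real" where
  "segment_point s = (\<lambda>i. if i = 0 then s else 0)"

lemma boundary_sphere_1: "boundary_sphere 1 = {segment_point (-1), segment_point 1}"
  by (auto simp: boundary_sphere_def topspace_Euclidean_space segment_point_def fun_eq_iff
      power2_eq_1_iff Suc_le_eq)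

lemma segment_point_in_closed_disc: "\<bar>s\<bar> \<le> 1 \<Longrightarrow> segment_point s \<in> closed_disc 1"
  by (auto simp: closed_disc_def topspace_Euclidean_space segment_point_def abs_square_le_1)

lemma boundary_sphere_nonempty: "n \<ge> 1 \<Longrightarrow> boundary_sphere n \<noteq> {}"
proof -
  assume "n \<ge> 1"
  then have "segment_point 1 \<in> boundary_sphere n"
    by (auto simp: boundary_sphere_def topspace_Euclidean_space segment_point_def
        if_distrib [where f = "\<lambda>x. x ^ 2"] cong: if_cong)
  then show ?thesis by blast
qed

section \<open>Transport graphs of finite CW complexes\<close>

text \<open>The properties of a cell \<open>e\<close> with characteristic map \<open>\<Phi>\<close> that the induction over cells needs, when \<open>A\<close> is the union of the cells
attached before.\<close>

definition attached_cell ::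
  "'b::topological_space set \<Rightarrow> 'b set \<Rightarrow> nat \<Rightarrow> ((nat \<Rightarrow> real) \<Rightarrow> 'b) \<Rightarrow> 'b set \<Rightarrow> bool" where
  "attached_cell X A n \<Phi> e \<longleftrightarrow> continuous_on (closed_disc n) \<Phi> \<and> \<Phi> \<in> closed_disc n \<rightarrow> X \<and>
     \<Phi> ` open_disc n = e \<and> inj_on \<Phi> (open_disc n) \<and> \<Phi> ` boundary_sphere n \<subseteq> A \<and> e \<inter> A = {}"

text \<open>A whole family of coverings is considered, because the finite graph constructed below has to serve all of its members at once.\<close>

locale finite_covers =
  fixes X :: "'b::topological_space set"
    and Y :: "'i \<Rightarrow> 'a::topological_space set" and q :: "'i \<Rightarrow> 'a \<Rightarrow> 'b"
  assumes cov: "covering_space (Y i) (q i) X"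
    and haus: "Hausdorff_space (top_of_set (Y i))"
    and fin: "x \<in> X \<Longrightarrow> finite {y \<in> Y i. q i y = x}"
begin

definition lifts :: "'i \<Rightarrow> nat \<Rightarrow> ((nat \<Rightarrow> real) \<Rightarrow> 'b) \<Rightarrow> ((nat \<Rightarrow> real) \<Rightarrow> 'a) set" where
  "lifts i n \<Phi> = {l. continuous_on (closed_disc n) l \<and> l \<in> closed_disc n \<rightarrow> Y i \<and>
     (\<forall>u\<in>closed_disc n. q i (l u) = \<Phi> u) \<and> l \<in> extensional (closed_disc n)}"

text \<open>Both pieces are closed in \<open>Y i\<close> and not merely in the preimage of \<open>A\<close>. In this form the property survives the
attachment of a cell, which adds a finite union of compact lifted discs to each piece.\<close>

definition splits :: "'i \<Rightarrow> 'b set \<Rightarrow> 'a set \<Rightarrow> 'a set \<Rightarrow> bool" where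
  "splits i A W0 W1 \<longleftrightarrow> closedin (top_of_set (Y i)) W0 \<and> closedin (top_of_set (Y i)) W1 \<and>
     W0 \<inter> W1 = {} \<and> W0 \<union> W1 = {y \<in> Y i. q i y \<in> A}"

definition stable :: "'i \<Rightarrow> (real \<Rightarrow> 'b) set \<Rightarrow> 'a set \<Rightarrow> bool" where
  "stable i P T \<longleftrightarrow> (\<forall>\<pi>\<in>P. \<forall>y y'. transports (Y i) (q i) \<pi> y y' \<longrightarrow> (y \<in> T \<longleftrightarrow> y' \<in> T))"

text \<open>The vertices \<open>S\<close> and edges \<open>P\<close> play the role of base points and generators for the fundamental groupoid of \<open>A\<close>, seen through
the coverings of the family: a set of points over \<open>S\<close> that is stable under transport along the edges is the trace on the fibres over \<open>S\<close> of a decomposition of the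
covering of \<open>A\<close>. The condition on path components lets the endpoints of later 1-cells be joined to vertices.\<close>

definition transport_graph :: "'b set \<Rightarrow> 'b set \<Rightarrow> (real \<Rightarrow> 'b) set \<Rightarrow> bool" where
  "transport_graph A S P \<longleftrightarrow> finite S \<and> S \<subseteq> A \<and> finite P \<and>
     (\<forall>\<pi>\<in>P. path \<pi> \<and> path_image \<pi> \<subseteq> X \<and> pathstart \<pi> \<in> S \<and> pathfinish \<pi> \<in> S) \<and>
     (\<forall>a\<in>A. \<exists>s\<in>S. path_component A a s) \<and>
     (\<forall>i. \<forall>T \<subseteq> {y \<in> Y i. q i y \<in> S}. stable i P T \<longrightarrow>
        (\<exists>W0 W1. splits i A W0 W1 \<and> {y \<in> W0. q i y \<in> S} = T))"

lemma lift_unique: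
  assumes "l \<in> lifts i n \<Phi>" "l' \<in> lifts i n \<Phi>" "u \<in> closed_disc n" "l u = l' u"
  shows "l = l'"
proof (rule extensionalityI [of _ "closed_disc n"])
  show "l x = l' x" if "x \<in> closed_disc n" for x
    using lift_unique_on_connected [OF cov contraction_imp_connected [OF closed_disc_contraction],
        where ?g1.0 = l and ?g2.0 = l' and f = \<Phi> and a = u and x = x] assms that
    by (auto simp: lifts_def)
qed (use assms in \<open>auto simp: lifts_def\<close>)

lemma lift_exists:
  assumes "attached_cell X A n \<Phi> e" "u \<in> closed_disc n" "y \<in> Y i" "q i y = \<Phi> u"
  obtains l where "l \<in> lifts i n \<Phi>" "l u = y"
proof -
  obtain g where "continuous_on (closed_disc n) g" "g \<in> closed_disc n \<rightarrow> Y i"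
    "\<And>x. x \<in> closed_disc n \<Longrightarrow> q i (g x) = \<Phi> x" "g u = y"
    using covering_space_lift_contractible [OF cov closed_disc_contraction, of n \<Phi> u y i] assms
    unfolding attached_cell_def by metis
  then show thesis
    using assms(2) by (intro that [of "restrict g (closed_disc n)"]) (auto simp: lifts_def Pi_iff)
qed

lemma finite_lifts:
  assumes "attached_cell X A n \<Phi> e"
  shows "finite (lifts i n \<Phi>)"
proof (rule finite_imageD)
  have 0: "(\<lambda>i. 0) \<in> closed_disc n"
    using closed_disc_contraction by (simp add: contraction_def)
  then show "inj_on (\<lambda>l. l (\<lambda>i. 0)) (lifts i n \<Phi>)"
    using lift_unique by (blast intro: inj_onI)
  have "(\<lambda>l. l (\<lambda>i. 0)) ` lifts i n \<Phi> \<subseteq> {y \<in> Y i. q i y = \<Phi> (\<lambda>i. 0)}"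
    using 0 by (auto simp: lifts_def)
  moreover have "\<Phi> (\<lambda>i. 0) \<in> X"
    using assms 0 by (auto simp: attached_cell_def)
  ultimately show "finite ((\<lambda>l. l (\<lambda>i. 0)) ` lifts i n \<Phi>)"
    using fin finite_subset by blast
qed

lemma closedin_lifted_discs:
  assumes "attached_cell X A n \<Phi> e" "L \<subseteq> lifts i n \<Phi>"
  shows "closedin (top_of_set (Y i)) (\<Union>l\<in>L. l ` closed_disc n)"
proof (rule closedin_Union)
  show "finite ((\<lambda>l. l ` closed_disc n) ` L)"
    using finite_lifts [OF assms(1)] assms(2) finite_subset by blast
  fix Z assume "Z \<in> (\<lambda>l. l ` closed_disc n) ` L"
  then obtain l where "l \<in> lifts i n \<Phi>" "Z = l ` closed_disc n"
    using assms(2) by blast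
  then have "compact Z" "Z \<subseteq> Y i"
    using compact_closed_disc by (auto simp: lifts_def intro: compact_continuous_image)
  then show "closedin (top_of_set (Y i)) Z"
    by (intro compactin_imp_closedin [OF haus]) (simp add: compactin_subtopology)
qed

text \<open>The preimage of the open cell consists of the interiors of the lifts of its characteristic map, and distinct lifts are disjoint
over the open cell. So one may decide for each lifted disc separately to which piece it is added, provided that its boundary
already lies in that piece.\<close>

lemma splits_attach_cell:
  assumes cell: "attached_cell X A n \<Phi> e" and W: "splits i A W0 W1"
    and L: "L \<subseteq> lifts i n \<Phi>"
    and L0: "\<And>l. l \<in> L \<Longrightarrow> l ` boundary_sphere n \<subseteq> W0"
    and L1: "\<And>l. l \<in> lifts i n \<Phi> - L \<Longrightarrow> l ` boundary_sphere n \<subseteq> W1"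
  shows "splits i (A \<union> e) (W0 \<union> (\<Union>l\<in>L. l ` closed_disc n))
           (W1 \<union> (\<Union>l\<in>lifts i n \<Phi> - L. l ` closed_disc n))"
    (is "splits i _ (W0 \<union> ?R0) (W1 \<union> ?R1)")
proof -
  have Phi: "\<Phi> ` open_disc n = e" "inj_on \<Phi> (open_disc n)" "\<Phi> ` boundary_sphere n \<subseteq> A" "e \<inter> A = {}"
    using cell by (auto simp: attached_cell_def)
  have WA: "q i y \<in> A" if "y \<in> W0 \<union> W1" for y
    using W that by (auto simp: splits_def)
  have lq: "q i (l u) = \<Phi> u" "l u \<in> Y i" if "l \<in> lifts i n \<Phi>" "u \<in> closed_disc n" for l u
    using that by (auto simp: lifts_def)
  have on_bd: "l u \<in> W0 \<union> W1 \<longleftrightarrow> u \<in> boundary_sphere n"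
    if "l \<in> lifts i n \<Phi>" "u \<in> closed_disc n" for l u
  proof
    assume "l u \<in> W0 \<union> W1"
    then have "\<Phi> u \<in> A"
      using WA lq that by metis
    then show "u \<in> boundary_sphere n"
      using Phi(1,4) that(2) by (auto simp: closed_disc_eq)
  next
    assume "u \<in> boundary_sphere n"
    then show "l u \<in> W0 \<union> W1"
      using L0 L1 that(1) by (cases "l \<in> L") blast+
  qed
  have dj: "W0 \<inter> W1 = {}"
    using W by (simp add: splits_def)
  have "W0 \<inter> ?R1 = {}"
  proof -
    have False if l: "l \<in> lifts i n \<Phi> - L" "u \<in> closed_disc n" "l u \<in> W0" for l u
    proof -
      have "u \<in> boundary_sphere n"
        using on_bd l by blast
      then show False
        using L1 l dj by blast
    qed
    then show ?thesis by blast
  qed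
  moreover have "?R0 \<inter> W1 = {}"
  proof -
    have False if l: "l \<in> L" "u \<in> closed_disc n" "l u \<in> W1" for l u
    proof -
      have "u \<in> boundary_sphere n"
        using on_bd l L by blast
      then show False
        using L0 l dj by blast
    qed
    then show ?thesis by blast
  qed
  moreover have "?R0 \<inter> ?R1 = {}"
  proof -
    have False if l: "l \<in> L" "u \<in> closed_disc n" and l': "l' \<in> lifts i n \<Phi> - L" "v \<in> closed_disc n"
      and eq: "l u = l' v" for l l' u v
    proof -
      have bd: "u \<in> boundary_sphere n \<longleftrightarrow> v \<in> boundary_sphere n"
        using on_bd [of l u] on_bd [of l' v] l l' L eq by auto
      show False
      proof (cases "u \<in> boundary_sphere n")
        case True
        then have "l u \<in> W0" "l' v \<in> W1"
          using L0 [OF l(1)] L1 [OF l'(1)] bd by auto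
        then show False
          using dj eq by auto
      next
        case False
        then have "u \<in> open_disc n" "v \<in> open_disc n"
          using bd l(2) l'(2) by (auto simp: closed_disc_eq)
        moreover have "\<Phi> u = \<Phi> v"
          using lq l l' L eq by (metis DiffD1 subsetD)
        ultimately have "u = v"
          using Phi(2) by (auto dest: inj_onD)
        then have "l = l'"
          using lift_unique [of l i n \<Phi> l' u] l l' L eq by auto
        then show False
          using l l' by blast
      qed
    qed
    then show ?thesis by blast
  qed
  moreover have "{y \<in> Y i. q i y \<in> A \<union> e} \<subseteq> (W0 \<union> ?R0) \<union> (W1 \<union> ?R1)"
  proof
    fix y assume y: "y \<in> {y \<in> Y i. q i y \<in> A \<union> e}"
    show "y \<in> (W0 \<union> ?R0) \<union> (W1 \<union> ?R1)"
    proof (cases "q i y \<in> A")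
      case True
      then show ?thesis
        using W y by (auto simp: splits_def)
    next
      case False
      then obtain u where u: "u \<in> closed_disc n" "q i y = \<Phi> u"
        using y Phi(1) by (auto simp: closed_disc_eq)
      then obtain l where "l \<in> lifts i n \<Phi>" "l u = y"
        using lift_exists [OF cell u(1)] y by blast
      then show ?thesis
        using u by blast
    qed
  qed
  moreover have "(W0 \<union> ?R0) \<union> (W1 \<union> ?R1) \<subseteq> {y \<in> Y i. q i y \<in> A \<union> e}"
  proof -
    have "\<Phi> u \<in> A \<union> e" if "u \<in> closed_disc n" for u
      using that Phi by (auto simp: closed_disc_eq)
    then have "l u \<in> {y \<in> Y i. q i y \<in> A \<union> e}" if "l \<in> lifts i n \<Phi>" "u \<in> closed_disc n" for l u
      using lq that by simp
    then have "?R0 \<union> ?R1 \<subseteq> {y \<in> Y i. q i y \<in> A \<union> e}"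
      using L by blast
    moreover have "W0 \<union> W1 \<subseteq> {y \<in> Y i. q i y \<in> A \<union> e}"
      using W by (auto simp: splits_def)
    ultimately show ?thesis by blast
  qed
  moreover have "closedin (top_of_set (Y i)) (W0 \<union> ?R0)" "closedin (top_of_set (Y i)) (W1 \<union> ?R1)"
    using W closedin_lifted_discs [OF cell] L by (auto simp: splits_def intro!: closedin_Un)
  moreover have "(W0 \<union> R0) \<inter> (W1 \<union> R1) = {}"
    if "W0 \<inter> R1 = {}" "R0 \<inter> W1 = {}" "R0 \<inter> R1 = {}" for R0 R1
    using that dj by blast
  ultimately show ?thesis
    unfolding splits_def by (metis (no_types, lifting) subset_antisym)
qed

lemma splits_connected:
  assumes W: "splits i A W0 W1" and Z: "connected Z" "Z \<subseteq> {y \<in> Y i. q i y \<in> A}"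
  shows "Z \<subseteq> W0 \<or> Z \<subseteq> W1"
proof -
  obtain C0 C1 where C: "closed C0" "W0 = Y i \<inter> C0" "closed C1" "W1 = Y i \<inter> C1"
    using W unfolding splits_def closedin_closed by metis
  have "Z \<subseteq> C0 \<union> C1" "C0 \<inter> C1 \<inter> Z = {}"
    using W Z(2) C by (auto simp: splits_def)
  then have "C0 \<inter> Z = {} \<or> C1 \<inter> Z = {}"
    using Z(1) C by (metis connected_closed)
  then show ?thesis
    using W Z(2) C unfolding splits_def by blast
qed

lemma splits_transport:
  assumes W: "splits i A W0 W1" and t: "transports (Y i) (q i) \<alpha> y y'" and A: "path_image \<alpha> \<subseteq> A"
  shows "y \<in> W0 \<longleftrightarrow> y' \<in> W0"
proof -
  obtain \<eta> where \<eta>: "path \<eta>" "path_image \<eta> \<subseteq> Y i" "\<And>t. t \<in> {0..1} \<Longrightarrow> q i (\<eta> t) = \<alpha> t"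
    "pathstart \<eta> = y" "pathfinish \<eta> = y'"
    using t by (auto simp: transports_def)
  have "path_image \<eta> \<subseteq> {y \<in> Y i. q i y \<in> A}"
    using \<eta>(2,3) A by (auto simp: path_image_def)
  then have "path_image \<eta> \<subseteq> W0 \<or> path_image \<eta> \<subseteq> W1"
    using splits_connected [OF W] connected_path_image [OF \<eta>(1)] by blast
  moreover have "y \<in> path_image \<eta>" "y' \<in> path_image \<eta>"
    using \<eta>(4,5) by auto
  ultimately show ?thesis
    using W unfolding splits_def by blast
qed

end

context finite_covers begin

lemma transport_graphD:
  assumes "transport_graph A S P"
  shows "finite S" "S \<subseteq> A" "finite P"
    and "\<And>\<pi>. \<pi> \<in> P \<Longrightarrow> path \<pi> \<and> path_image \<pi> \<subseteq> X \<and> pathstart \<pi> \<in> S \<and> pathfinish \<pi> \<in> S"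
    and "\<And>a. a \<in> A \<Longrightarrow> \<exists>s\<in>S. path_component A a s"
    and "\<And>i T. T \<subseteq> {y \<in> Y i. q i y \<in> S} \<Longrightarrow> stable i P T \<Longrightarrow>
      \<exists>W0 W1. splits i A W0 W1 \<and> {y \<in> W0. q i y \<in> S} = T"
  using assms by (simp_all add: transport_graph_def)

lemma transport_graphI:
  assumes "finite S" "S \<subseteq> A" "finite P"
    and "\<And>\<pi>. \<pi> \<in> P \<Longrightarrow> path \<pi> \<and> path_image \<pi> \<subseteq> X \<and> pathstart \<pi> \<in> S \<and> pathfinish \<pi> \<in> S"
    and "\<And>a. a \<in> A \<Longrightarrow> \<exists>s\<in>S. path_component A a s"
    and "\<And>i T. T \<subseteq> {y \<in> Y i. q i y \<in> S} \<Longrightarrow> stable i P T \<Longrightarrow>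
      \<exists>W0 W1. splits i A W0 W1 \<and> {y \<in> W0. q i y \<in> S} = T"
  shows "transport_graph A S P"
  using assms by (simp add: transport_graph_def)

lemma path_component_in_disc:
  assumes cell: "attached_cell X A n \<Phi> e" and uv: "u \<in> closed_disc n" "v \<in> closed_disc n"
  shows "path_component (A \<union> e) (\<Phi> u) (\<Phi> v)"
proof -
  have Phi: "continuous_on (closed_disc n) \<Phi>" "\<Phi> ` closed_disc n \<subseteq> A \<union> e"
    using cell by (auto simp: attached_cell_def closed_disc_eq)
  have "path_component (A \<union> e) (\<Phi> (\<lambda>i. 0)) (\<Phi> w)" if w: "w \<in> closed_disc n" for w
    unfolding path_component_def
  proof (intro exI conjI)
    let ?c = "\<lambda>t. \<Phi> ((\<lambda>w i. fst w * snd w i) (t, w))"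
    note c = contraction_path [OF closed_disc_contraction w]
    show "path ?c"
      unfolding path_def by (rule continuous_on_compose2 [OF Phi(1) c(1)]) (use c(2) in auto)
    show "path_image ?c \<subseteq> A \<union> e"
      unfolding path_image_def using c(2) Phi(2) by (auto simp: Pi_iff image_subset_iff)
  qed (auto simp: pathstart_def pathfinish_def)
  then show ?thesis
    using uv by (meson path_component_sym path_component_trans)
qed

text \<open>A 0-cell becomes a new vertex; the lifts of its characteristic map are the points over it.\<close>

lemma transport_graph_attach_point:
  assumes A: "transport_graph A S P" and cell: "attached_cell X A 0 \<Phi> e"
  shows "transport_graph (A \<union> e) (S \<union> e) P"
proof -
  have e: "e = {\<Phi> (\<lambda>i. 0)}" "\<Phi> (\<lambda>i. 0) \<notin> A"
    using cell by (auto simp: attached_cell_def disc_dim0)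
  have S: "S \<subseteq> A" using A by (simp add: transport_graph_def)
  have "\<exists>W0 W1. splits i (A \<union> e) W0 W1 \<and> {y \<in> W0. q i y \<in> S \<union> e} = T"
    if T: "T \<subseteq> {y \<in> Y i. q i y \<in> S \<union> e}" "stable i P T" for i T
  proof -
    define T' where "T' = {y \<in> T. q i y \<in> S}"
    have "stable i P T'"
    proof -
      have "q i y \<in> S \<and> q i y' \<in> S" if "\<pi> \<in> P" "transports (Y i) (q i) \<pi> y y'" for \<pi> y y'
        using transports_ends [OF that(2)] that(1) A by (simp add: transport_graph_def)
      then show ?thesis
        using T(2) by (auto simp: stable_def T'_def)
    qed
    moreover have "T' \<subseteq> {y \<in> Y i. q i y \<in> S}"
      using T by (auto simp: T'_def)
    ultimately obtain W0 W1 where W: "splits i A W0 W1" "{y \<in> W0. q i y \<in> S} = T'"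
      using transport_graphD(6) [OF A] by meson
    define L where "L = {l \<in> lifts i 0 \<Phi>. l (\<lambda>i. 0) \<in> T}"
    have "splits i (A \<union> e) (W0 \<union> (\<Union>l\<in>L. l ` closed_disc 0)) (W1 \<union> (\<Union>l\<in>lifts i 0 \<Phi> - L. l ` closed_disc 0))"
      by (rule splits_attach_cell [OF cell W(1)]) (auto simp: L_def disc_dim0)
    moreover have "{y \<in> W0 \<union> (\<Union>l\<in>L. l ` closed_disc 0). q i y \<in> S \<union> e} = T"
    proof (intro equalityI subsetI)
      fix y assume y: "y \<in> {y \<in> W0 \<union> (\<Union>l\<in>L. l ` closed_disc 0). q i y \<in> S \<union> e}"
      show "y \<in> T"
      proof (cases "y \<in> W0")
        case True
        then have "q i y \<in> A"
          using W(1) by (auto simp: splits_def)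
        then have "y \<in> {y \<in> W0. q i y \<in> S}"
          using y e True by auto
        then show ?thesis
          using W(2) T'_def by auto
      qed (use y in \<open>auto simp: L_def disc_dim0\<close>)
    next
      fix y assume y: "y \<in> T"
      show "y \<in> {y \<in> W0 \<union> (\<Union>l\<in>L. l ` closed_disc 0). q i y \<in> S \<union> e}"
      proof (cases "q i y \<in> S")
        case True
        then have "y \<in> T'"
          using y by (simp add: T'_def)
        then show ?thesis
          using W(2) by auto
      next
        case False
        then have qy: "q i y = \<Phi> (\<lambda>i. 0)" "y \<in> Y i"
          using y T(1) e by auto
        then obtain l where "l \<in> lifts i 0 \<Phi>" "l (\<lambda>i. 0) = y"
          using lift_exists [OF cell, of "\<lambda>i. 0" y i] by (auto simp: disc_dim0)
        then show ?thesis
          using y qy e by (auto simp: L_def disc_dim0)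
      qed
    qed
    ultimately show ?thesis by blast
  qed
  moreover have "\<exists>s\<in>S \<union> e. path_component (A \<union> e) a s" if "a \<in> A \<union> e" for a
  proof (cases "a \<in> A")
    case True
    then obtain s where "s \<in> S" "path_component A a s"
      using transport_graphD(5) [OF A] by blast
    then show ?thesis
      using path_component_of_subset [of A "A \<union> e" a s] by auto
  next
    case False
    then have "a \<in> e"
      using that by blast
    moreover have "path_component (A \<union> e) a a"
      using that by (rule path_component_refl)
    ultimately show ?thesis
      by blast
  qed
  moreover have "finite (S \<union> e)" "S \<union> e \<subseteq> A \<union> e"
    using transport_graphD(1,2) [OF A] e by auto
  ultimately show ?thesis
    using transport_graphD(3,4) [OF A] by (intro transport_graphI) auto
qed

text \<open>The stable set already decides on which side the boundary of each
lifted disc lies, and the disc is put on that side.\<close>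

lemma transport_graph_attach_general:
  assumes A: "transport_graph A S P" and cell: "attached_cell X A n \<Phi> e" and n: "n \<ge> 1"
    and P': "P \<subseteq> P'" "finite P'"
      "\<And>\<pi>. \<pi> \<in> P' \<Longrightarrow> path \<pi> \<and> path_image \<pi> \<subseteq> X \<and> pathstart \<pi> \<in> S \<and> pathfinish \<pi> \<in> S"
    and one_side: "\<And>i T W0 W1 l. stable i P' T \<Longrightarrow> splits i A W0 W1 \<Longrightarrow> {y \<in> W0. q i y \<in> S} = T \<Longrightarrow>
      l \<in> lifts i n \<Phi> \<Longrightarrow> l ` boundary_sphere n \<subseteq> W0 \<or> l ` boundary_sphere n \<subseteq> W1"
  shows "transport_graph (A \<union> e) S P'"
proof -
  have S: "S \<subseteq> A" using A by (simp add: transport_graph_def)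
  have disj: "A \<inter> e = {}" using cell by (auto simp: attached_cell_def)
  have "\<exists>W0 W1. splits i (A \<union> e) W0 W1 \<and> {y \<in> W0. q i y \<in> S} = T"
    if T: "T \<subseteq> {y \<in> Y i. q i y \<in> S}" "stable i P' T" for i T
  proof -
    have "stable i P T"
      using T(2) P'(1) by (auto simp: stable_def)
    then obtain W0 W1 where W: "splits i A W0 W1" "{y \<in> W0. q i y \<in> S} = T"
      using transport_graphD(6) [OF A T(1)] by meson
    define L where "L = {l \<in> lifts i n \<Phi>. l ` boundary_sphere n \<subseteq> W0}"
    have "splits i (A \<union> e) (W0 \<union> (\<Union>l\<in>L. l ` closed_disc n)) (W1 \<union> (\<Union>l\<in>lifts i n \<Phi> - L. l ` closed_disc n))"
    proof (rule splits_attach_cell [OF cell W(1)])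
      show "l ` boundary_sphere n \<subseteq> W1" if "l \<in> lifts i n \<Phi> - L" for l
        using one_side [OF T(2) W, of l] that by (auto simp: L_def)
    qed (auto simp: L_def)
    moreover have "{y \<in> W0 \<union> (\<Union>l\<in>L. l ` closed_disc n). q i y \<in> S} = T"
    proof -
      have "l u \<in> W0" if "l \<in> L" "u \<in> closed_disc n" "q i (l u) \<in> S" for l u
      proof -
        have "\<Phi> u \<in> A"
          using that S by (auto simp: L_def lifts_def)
        moreover have "\<Phi> ` open_disc n = e"
          using cell by (simp add: attached_cell_def)
        ultimately have "u \<in> boundary_sphere n"
          using that(2) disj by (auto simp: closed_disc_eq)
        then show ?thesis
          using that(1) by (auto simp: L_def)
      qed
      then show ?thesis
        using W(2) by blast
    qed
    ultimately show ?thesis by blast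
  qed
  moreover have "\<exists>s\<in>S. path_component (A \<union> e) a s" if a: "a \<in> A \<union> e" for a
  proof -
    obtain b where b: "b \<in> A" "path_component (A \<union> e) a b"
    proof (cases "a \<in> A")
      case True
      then show ?thesis
        using that [of a] by (simp add: path_component_refl)
    next
      case False
      then obtain u where u: "u \<in> closed_disc n" "a = \<Phi> u"
        using a cell by (auto simp: attached_cell_def closed_disc_eq)
      obtain v where v: "v \<in> boundary_sphere n"
        using boundary_sphere_nonempty [OF n] by blast
      then have "\<Phi> v \<in> A"
        using cell by (auto simp: attached_cell_def)
      then show ?thesis
        using that [of "\<Phi> v"] path_component_in_disc [OF cell u(1), of v] u v
        by (auto simp: closed_disc_eq)
    qed
    moreover obtain s where "s \<in> S" "path_component A b s"
      using transport_graphD(5) [OF A b(1)] by blast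
    ultimately show ?thesis
      using path_component_of_subset [of A "A \<union> e" b s] path_component_trans by blast
  qed
  moreover have "finite S" "S \<subseteq> A \<union> e"
    using transport_graphD(1,2) [OF A] by auto
  ultimately show ?thesis
    using P'(2,3) by (intro transport_graphI) auto
qed

text \<open>The two ends of a lifted 1-cell could lie on different sides. To exclude this, the 1-cell is completed by
paths in \<open>A\<close> to a path between vertices, which is added to the edges: transport along paths in \<open>A\<close> never changes
sides, and stability under the new edge settles the rest.\<close>

lemma transport_graph_attach_edge:
  assumes A: "transport_graph A S P" and cell: "attached_cell X A 1 \<Phi> e" and AX: "A \<subseteq> X"
  obtains \<pi> where "transport_graph (A \<union> e) S (insert \<pi> P)"
proof -
  define b where "b = segment_point"
  have bd: "boundary_sphere 1 = {b (-1), b 1}"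
    unfolding b_def by (rule boundary_sphere_1)
  note bd' = bd [unfolded One_nat_def]
  note in_disc = segment_point_in_closed_disc [unfolded One_nat_def]
  have Phi: "continuous_on (closed_disc 1) \<Phi>" "\<Phi> \<in> closed_disc 1 \<rightarrow> X"
    "\<Phi> (b (-1)) \<in> A" "\<Phi> (b 1) \<in> A"
    using cell bd by (auto simp: attached_cell_def closed_disc_eq)
  obtain s \<alpha> where \<alpha>: "s \<in> S" "path \<alpha>" "path_image \<alpha> \<subseteq> A" "pathstart \<alpha> = \<Phi> (b (-1))" "pathfinish \<alpha> = s"
    using transport_graphD(5) [OF A Phi(3)] unfolding path_component_def by blast
  obtain s' \<beta> where \<beta>: "s' \<in> S" "path \<beta>" "path_image \<beta> \<subseteq> A" "pathstart \<beta> = \<Phi> (b 1)" "pathfinish \<beta> = s'"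
    using transport_graphD(5) [OF A Phi(4)] unfolding path_component_def by blast
  define \<sigma> where "\<sigma> t = b (2 * t - 1)" for t :: real
  have \<sigma>: "continuous_on {0..1} \<sigma>" "\<sigma> \<in> {0..1} \<rightarrow> closed_disc 1" "\<sigma> ` {0..1} \<subseteq> closed_disc 1"
  proof -
    have "continuous_on {0..1} (\<lambda>t. \<sigma> t i)" for i
      by (cases "i = 0") (auto simp: \<sigma>_def b_def segment_point_def intro!: continuous_intros)
    then show "continuous_on {0..1} \<sigma>"
      by (rule continuous_on_coordinatewise_then_product)
    show "\<sigma> \<in> {0..1} \<rightarrow> closed_disc 1" "\<sigma> ` {0..1} \<subseteq> closed_disc 1"
      by (auto simp: \<sigma>_def b_def intro!: in_disc)
  qed
  define \<phi> where "\<phi> = \<Phi> \<circ> \<sigma>"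
  have \<phi>: "path \<phi>" "path_image \<phi> \<subseteq> X" "pathstart \<phi> = \<Phi> (b (-1))" "pathfinish \<phi> = \<Phi> (b 1)"
  proof -
    show "path \<phi>"
      unfolding path_def \<phi>_def
      by (rule continuous_on_compose [OF \<sigma>(1) continuous_on_subset [OF Phi(1) \<sigma>(3)]])
    show "path_image \<phi> \<subseteq> X"
      using \<sigma>(2) Phi(2) by (auto simp: path_image_def \<phi>_def)
  qed (auto simp: pathstart_def pathfinish_def \<phi>_def \<sigma>_def)
  define \<pi> where "\<pi> = reversepath \<alpha> +++ (\<phi> +++ \<beta>)"
  have \<pi>: "path \<pi>" "path_image \<pi> \<subseteq> X" "pathstart \<pi> \<in> S" "pathfinish \<pi> \<in> S"
    using \<alpha> \<beta> \<phi> AX by (auto simp: \<pi>_def path_image_join)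
  have "transport_graph (A \<union> e) S (insert \<pi> P)"
  proof (rule transport_graph_attach_general [OF A cell])
    fix i T W0 W1 l
    assume T: "stable i (insert \<pi> P) T" and W: "splits i A W0 W1" and WT: "{y \<in> W0. q i y \<in> S} = T"
      and l: "l \<in> lifts i 1 \<Phi>"
    have inD: "b (-1) \<in> closed_disc 1" "b 1 \<in> closed_disc 1"
      by (simp_all add: b_def in_disc)
    have lY: "l (b (-1)) \<in> Y i" "l (b 1) \<in> Y i" "q i (l (b (-1))) = \<Phi> (b (-1))" "q i (l (b 1)) = \<Phi> (b 1)"
      using l inD by (auto simp: lifts_def)
    have tl: "transports (Y i) (q i) \<phi> (l (b (-1))) (l (b 1))"
      unfolding transports_def
    proof (intro exI conjI)
      have "continuous_on (closed_disc 1) l"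
        using l by (simp add: lifts_def)
      then show "path (l \<circ> \<sigma>)"
        unfolding path_def
        by (rule continuous_on_compose [OF \<sigma>(1) continuous_on_subset [OF _ \<sigma>(3)]])
      show "path_image (l \<circ> \<sigma>) \<subseteq> Y i" "\<forall>t\<in>{0..1}. q i ((l \<circ> \<sigma>) t) = \<phi> t"
        using l \<sigma>(2) by (auto simp: lifts_def path_image_def \<phi>_def)
    qed (auto simp: pathstart_def pathfinish_def \<sigma>_def)
    obtain y where y: "transports (Y i) (q i) \<alpha> (l (b (-1))) y"
      using transports_exists [OF cov \<alpha>(2), of "l (b (-1))" i] lY \<alpha> AX by auto
    obtain y' where y': "transports (Y i) (q i) \<beta> (l (b 1)) y'"
      using transports_exists [OF cov \<beta>(2), of "l (b 1)" i] lY \<beta> AX by auto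
    have "transports (Y i) (q i) \<pi> y y'"
      unfolding \<pi>_def by (intro transports_join [OF transports_reverse [OF y]] transports_join [OF tl y'])
    then have "y \<in> T \<longleftrightarrow> y' \<in> T"
      using T by (auto simp: stable_def)
    moreover have "q i y \<in> S" "q i y' \<in> S"
      using transports_ends [OF y] transports_ends [OF y'] \<alpha> \<beta> by auto
    ultimately have "y \<in> W0 \<longleftrightarrow> y' \<in> W0"
      using WT by auto
    then have "l (b (-1)) \<in> W0 \<longleftrightarrow> l (b 1) \<in> W0"
      using splits_transport [OF W y] splits_transport [OF W y'] \<alpha> \<beta> by auto
    moreover have "l (b (-1)) \<in> W0 \<union> W1" "l (b 1) \<in> W0 \<union> W1"
      using W lY Phi by (auto simp: splits_def)
    ultimately show "l ` boundary_sphere 1 \<subseteq> W0 \<or> l ` boundary_sphere 1 \<subseteq> W1"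
      by (auto simp: bd')
  qed (use transport_graphD(3,4) [OF A] \<pi> in auto)
  then show thesis
    by (rule that)
qed

text \<open>From dimension 2 on, the boundary sphere is connected, so each lifted boundary lies on one side and no new edge is needed.\<close>

lemma transport_graph_attach_cell:
  assumes A: "transport_graph A S P" and cell: "attached_cell X A n \<Phi> e" and AX: "A \<subseteq> X"
  obtains S' P' where "transport_graph (A \<union> e) S' P'"
proof -
  consider "n = 0" | "n = 1" | "n \<ge> 2" by linarith
  then show thesis
  proof cases
    case 1
    then show ?thesis
      using transport_graph_attach_point [OF A] cell that by auto
  next
    case 2
    then show ?thesis
      using transport_graph_attach_edge [OF A _ AX] cell that by metis
  next
    case 3
    have "transport_graph (A \<union> e) S P"
    proof (rule transport_graph_attach_general [OF A cell])
      fix i T W0 W1 l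
      assume W: "splits i A W0 W1" and l: "l \<in> lifts i n \<Phi>"
      have "connected (l ` boundary_sphere n)"
        using l connected_boundary_sphere [OF 3]
        by (auto simp: lifts_def closed_disc_eq intro!: connected_continuous_image intro: continuous_on_subset)
      moreover have "l ` boundary_sphere n \<subseteq> {y \<in> Y i. q i y \<in> A}"
        using l cell by (auto simp: lifts_def closed_disc_eq attached_cell_def)
      ultimately show "l ` boundary_sphere n \<subseteq> W0 \<or> l ` boundary_sphere n \<subseteq> W1"
        by (rule splits_connected [OF W])
    qed (use 3 transport_graphD(3,4) [OF A] in auto)
    then show ?thesis
      by (rule that)
  qed
qed

lemma CW_structure_attached_cell:
  assumes CW: "CW_structure (top_of_set X) E d \<Phi>" and F: "e \<in> E" "F \<subseteq> E" "e \<notin> F"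
    and lower: "\<And>f. f \<in> E \<Longrightarrow> d f < d e \<Longrightarrow> f \<in> F"
  shows "attached_cell X (\<Union>F) (d e) (\<Phi> e) e"
proof -
  have *: "pairwise disjnt E" "\<Union>E = X"
    "continuous_map (subtopology (Euclidean_space (d e)) (closed_disc (d e))) (top_of_set X) (\<Phi> e)"
    "homeomorphic_map (subtopology (Euclidean_space (d e)) (open_disc (d e)))
                (subtopology (top_of_set X) e) (\<Phi> e)"
    "\<exists>F\<subseteq>E. finite F \<and> (\<forall>f\<in>F. d f < d e) \<and> \<Phi> e ` boundary_sphere (d e) \<subseteq> \<Union>F"
    using CW F(1) unfolding CW_structure_def by auto
  have "e \<subseteq> X"
    using *(2) F(1) by blast
  have "\<Phi> e ` open_disc (d e) = e" "inj_on (\<Phi> e) (open_disc (d e))"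
    using *(4) \<open>e \<subseteq> X\<close> homeomorphic_imp_surjective_map [OF *(4)] homeomorphic_imp_injective_map [OF *(4)]
    by (auto simp: subtopology_Euclidean_space [OF disc_subsets(2)] Int_absorb1)
  moreover have "continuous_on (closed_disc (d e)) (\<Phi> e)" "\<Phi> e \<in> closed_disc (d e) \<rightarrow> X"
    using *(3) by (auto simp: subtopology_Euclidean_space [OF disc_subsets(1)])
  moreover have "e \<inter> \<Union>F = {}"
    using *(1) F by (fastforce simp: pairwise_def disjnt_def)
  moreover have "\<Phi> e ` boundary_sphere (d e) \<subseteq> \<Union>F"
    using *(5) lower by blast
  ultimately show ?thesis
    by (simp add: attached_cell_def)
qed

text \<open>The cells are attached in the order of their dimensions. The induction runs over the sets of cells that contain, along with a cell, all cells of
smaller dimension; removing a cell of maximal dimension preserves this property.\<close>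

theorem finite_CW_transport_graph:
  assumes CW: "CW_structure (top_of_set X) E d \<Phi>" and fin: "finite E"
  obtains S P where "transport_graph X S P"
proof -
  have UE: "\<Union>E = X"
    using CW by (simp add: CW_structure_def)
  have "\<exists>S P. transport_graph (\<Union>F) S P"
    if "F \<subseteq> E" "\<And>e f. e \<in> F \<Longrightarrow> f \<in> E \<Longrightarrow> d f < d e \<Longrightarrow> f \<in> F" for F
    using that
  proof (induction "card F" arbitrary: F)
    case 0
    then have "F = {}"
      using fin finite_subset by fastforce
    then have "transport_graph (\<Union>F) {} {}"
      by (auto simp: transport_graph_def splits_def intro!: exI [of _ "{}"])
    then show ?case by blast
  next
    case (Suc m)
    have finF: "finite F" "F \<noteq> {}"
      using Suc.hyps(2) by (auto intro: card_ge_0_finite)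
    then have "Max (d ` F) \<in> d ` F"
      by simp
    then obtain e where e: "e \<in> F" "d e = Max (d ` F)"
      by auto
    then have top: "d f \<le> d e" if "f \<in> F" for f
      using finF that by simp
    obtain S P where SP: "transport_graph (\<Union>(F - {e})) S P"
    proof -
      have "\<exists>S P. transport_graph (\<Union>(F - {e})) S P"
      proof (rule Suc.hyps(1))
        show "m = card (F - {e})"
          using Suc.hyps(2) e(1) finF by simp
        show "F - {e} \<subseteq> E"
          using Suc.prems(1) by blast
        show "f \<in> F - {e}" if "g \<in> F - {e}" "f \<in> E" "d f < d g" for g f
          using that Suc.prems(2) [of g f] top [of g] by force
      qed
      then show ?thesis
        using that by blast
    qed
    have "attached_cell X (\<Union>(F - {e})) (d e) (\<Phi> e) e"
    proof (rule CW_structure_attached_cell [OF CW])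
      show "e \<in> E" "F - {e} \<subseteq> E" "e \<notin> F - {e}"
        using Suc.prems(1) e(1) by auto
      show "f \<in> F - {e}" if "f \<in> E" "d f < d e" for f
        using Suc.prems(2) [OF e(1) that] that(2) by auto
    qed
    moreover have "\<Union>(F - {e}) \<subseteq> X"
      using Suc.prems(1) UE by blast
    ultimately obtain S' P' where "transport_graph (\<Union>(F - {e}) \<union> e) S' P'"
      using transport_graph_attach_cell [OF SP] by metis
    moreover have "\<Union>(F - {e}) \<union> e = \<Union>F"
      using e by auto
    ultimately show ?case
      by metis
  qed
  from this [of E] show thesis
    using that UE by auto
qed

end

text \<open>A connected covering space admits no nontrivial decomposition into two closed pieces, so transport along the edges is transitive on
the fibres over the vertices.\<close>

lemma (in finite_covers) stable_set_is_everything: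
  assumes P: "transport_graph X S P" and Y: "connected (Y i)"
    and T: "T \<subseteq> {y \<in> Y i. q i y \<in> S}" "stable i P T" "T \<noteq> {}"
  shows "T = {y \<in> Y i. q i y \<in> S}"
proof -
  obtain W0 W1 where W: "splits i X W0 W1" "{y \<in> W0. q i y \<in> S} = T"
    using transport_graphD(6) [OF P T(1,2)] by blast
  have "Y i \<subseteq> {y \<in> Y i. q i y \<in> X}"
    using covering_space_imp_surjective [OF cov] by blast
  then have "Y i \<subseteq> W0 \<or> Y i \<subseteq> W1"
    using splits_connected [OF W(1) Y] by blast
  moreover have "\<not> Y i \<subseteq> W1"
    using W T by (auto simp: splits_def)
  ultimately show ?thesis
    using W(2) T(1) by blast
qed

section \<open>The tower of deck groups\<close>

locale self_cover_tower =
  fixes X :: "'a::topological_space set" and p :: "'a \<Rightarrow> 'a" and k :: nat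
  assumes conX: "connected X" and neX: "X \<noteq> {}" and hausX: "Hausdorff_space (top_of_set X)"
    and reg: "\<And>n. n \<ge> 1 \<Longrightarrow> regular_covering_space X (p ^^ n) X"
    and k: "k > 1" and card_fibre_p: "\<And>y. y \<in> X \<Longrightarrow> card {x \<in> X. p x = y} = k"
begin

lemma cover: "covering_space X (p ^^ n) X"
proof (cases "n = 0")
  case True
  then show ?thesis
    using homeomorphism_imp_covering_space [OF homeomorphism_ident, of X] by (simp add: id_def)
next
  case False
  then show ?thesis
    using reg [of n] by (simp add: regular_covering_space_def)
qed

lemma pow_image: "(p ^^ n) ` X = X"
  using covering_space_imp_surjective [OF cover] .

lemma pow_in: "x \<in> X \<Longrightarrow> (p ^^ n) x \<in> X"
  using pow_image by blast

lemma p_in: "x \<in> X \<Longrightarrow> p x \<in> X"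
  using pow_in [of x 1] by simp

lemma p_onto: "y \<in> X \<Longrightarrow> \<exists>x\<in>X. p x = y"
proof -
  assume "y \<in> X"
  then have "y \<in> p ` X"
    using pow_image [of 1] by simp
  then show ?thesis by blast
qed

lemma pow_onto: "y \<in> X \<Longrightarrow> \<exists>x\<in>X. (p ^^ n) x = y"
  using pow_image [of n] by (metis imageE)

lemma card_fibre: "y \<in> X \<Longrightarrow> card {x \<in> X. (p ^^ n) x = y} = k ^ n"
proof (induction n arbitrary: y)
  case 0
  then have "{x \<in> X. (p ^^ 0) x = y} = {y}" by auto
  then show ?case by simp
next
  case (Suc n)
  have fin: "finite {x \<in> X. (p ^^ n) x = z}" if "z \<in> X" for z
    using Suc.IH [OF that] k by (intro card_ge_0_finite) simp
  have "finite {z \<in> X. p z = y}"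
    using card_fibre_p [OF Suc.prems] k by (intro card_ge_0_finite) simp
  moreover have "{x \<in> X. (p ^^ Suc n) x = y} = (\<Union>z\<in>{z \<in> X. p z = y}. {x \<in> X. (p ^^ n) x = z})"
    using pow_in by auto
  ultimately have "card {x \<in> X. (p ^^ Suc n) x = y} = (\<Sum>z\<in>{z \<in> X. p z = y}. card {x \<in> X. (p ^^ n) x = z})"
    using fin by (auto intro!: card_UN_disjoint)
  also have "\<dots> = (\<Sum>z\<in>{z \<in> X. p z = y}. k ^ n)"
    by (rule sum.cong) (use Suc.IH in auto)
  finally show ?case
    using card_fibre_p [OF Suc.prems] by simp
qed

sublocale finite_covers X "\<lambda>n. X" "\<lambda>n. p ^^ n"
proof
  show "finite {y \<in> X. (p ^^ i) y = x}" if "x \<in> X" for x i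
    using card_fibre [OF that, of i] k by (intro card_ge_0_finite) simp
qed (use cover hausX in auto)

text \<open>Deck transformations are normalised to be the identity off \<open>X\<close>, so that equality of maps is equality on \<open>X\<close> and the group
operation is composition of functions.\<close>

definition deck :: "nat \<Rightarrow> ('a \<Rightarrow> 'a) set" where
  "deck n = {f. continuous_on X f \<and> f \<in> X \<rightarrow> X \<and> (\<forall>x\<in>X. (p ^^ n) (f x) = (p ^^ n) x) \<and> (\<forall>x. x \<notin> X \<longrightarrow> f x = x)}"

lemma deckD:
  assumes "f \<in> deck n"
  shows "continuous_on X f" "\<And>x. x \<in> X \<Longrightarrow> f x \<in> X" "\<And>x. x \<in> X \<Longrightarrow> (p ^^ n) (f x) = (p ^^ n) x"
    "\<And>x. x \<notin> X \<Longrightarrow> f x = x"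
  using assms by (auto simp: deck_def)

lemma deck_eqI:
  assumes f: "f \<in> deck n" "g \<in> deck n" and x: "x \<in> X" "f x = g x"
  shows "f = g"
proof
  fix z
  show "f z = g z"
  proof (cases "z \<in> X")
    case True
    show ?thesis
      by (rule lift_unique_on_connected [OF cover [of n] conX, where f = "p ^^ n" and a = x])
        (use f x True in \<open>auto simp: deck_def\<close>)
  qed (use f deckD(4) in metis)
qed

lemma deck_transitive:
  assumes "x \<in> X" "y \<in> X" "(p ^^ n) x = (p ^^ n) y"
  obtains f where "f \<in> deck n" "f x = y"
proof (cases "n = 0")
  case True
  then show thesis
    using assms by (intro that [of "\<lambda>x. x"]) (auto simp: deck_def)
next
  case False
  then obtain f g where f: "homeomorphism X X f g" "\<And>x. x \<in> X \<Longrightarrow> (p ^^ n) (f x) = (p ^^ n) x" "f x = y"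
    using reg [of n] assms unfolding regular_covering_space_def deck_transformation_def by fastforce
  show thesis
  proof (rule that [of "\<lambda>x. if x \<in> X then f x else x"])
    have "continuous_on X (\<lambda>x. if x \<in> X then f x else x)"
      using f(1) by (subst continuous_on_cong [of X X _ f]) (auto simp: homeomorphism_def)
    then show "(\<lambda>x. if x \<in> X then f x else x) \<in> deck n"
      using f by (auto simp: deck_def homeomorphism_def)
  qed (use f assms in auto)
qed

lemma id_deck: "id \<in> deck n"
  by (auto simp: deck_def)

lemma comp_deck:
  assumes "f \<in> deck n" "g \<in> deck n"
  shows "f \<circ> g \<in> deck n"
proof -
  have "g ` X \<subseteq> X"
    using deckD(2) [OF assms(2)] by blast
  then have "continuous_on X (f \<circ> g)"
    using deckD(1) [OF assms(1)] deckD(1) [OF assms(2)] continuous_on_compose continuous_on_subset by blast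
  then show ?thesis
    using assms by (auto simp: deck_def Pi_iff)
qed

lemma inverse_deck:
  assumes "f \<in> deck n"
  obtains g where "g \<in> deck n" "g \<circ> f = id" "f \<circ> g = id"
proof -
  obtain x where x: "x \<in> X" using neX by blast
  obtain g where g: "g \<in> deck n" "g (f x) = x"
    using deck_transitive [of "f x" x n] deckD [OF assms] x by metis
  have "g \<circ> f = id"
    by (rule deck_eqI [OF comp_deck [OF g(1) assms] id_deck x]) (simp add: g)
  moreover have "f \<circ> g = id"
    by (rule deck_eqI [OF comp_deck [OF assms g(1)] id_deck, of "f x"])
      (use g x deckD [OF assms] in auto)
  ultimately show thesis
    using that g(1) by blast
qed

lemma deck_mono:
  assumes "m \<le> n"
  shows "deck m \<subseteq> deck n"
proof -
  have "p ^^ n = p ^^ (n - m) \<circ> p ^^ m"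
    using assms by (simp flip: funpow_add)
  then show ?thesis
    by (auto simp: deck_def)
qed

definition deck_group :: "('a \<Rightarrow> 'a) monoid" where
  "deck_group = \<lparr>carrier = (\<Union>n. deck n), mult = (\<circ>), one = id\<rparr>"

lemma deck_group_simps [simp]:
  "mult deck_group = (\<circ>)" "\<one>\<^bsub>deck_group\<^esub> = id" "carrier deck_group = (\<Union>n. deck n)"
  by (simp_all add: deck_group_def)

lemma group_deck_group: "group deck_group"
proof (rule groupI)
  fix f g assume "f \<in> carrier deck_group" "g \<in> carrier deck_group"
  then obtain m n where "f \<in> deck m" "g \<in> deck n"
    by auto
  then have "f \<circ> g \<in> deck (max m n)"
    using deck_mono [of m "max m n"] deck_mono [of n "max m n"] by (auto intro: comp_deck)
  then show "f \<otimes>\<^bsub>deck_group\<^esub> g \<in> carrier deck_group"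
    by auto
next
  fix f assume "f \<in> carrier deck_group"
  then obtain n where "f \<in> deck n" by auto
  then obtain g where "g \<in> deck n" "g \<circ> f = id"
    by (rule inverse_deck)
  then show "\<exists>g\<in>carrier deck_group. g \<otimes>\<^bsub>deck_group\<^esub> f = \<one>\<^bsub>deck_group\<^esub>"
    by auto
qed (use id_deck in \<open>auto simp: o_assoc\<close>)

lemma card_deck: "card (deck n) = k ^ n" and finite_deck: "finite (deck n)"
proof -
  obtain x where x: "x \<in> X" using neX by blast
  have "bij_betw (\<lambda>f. f x) (deck n) {y \<in> X. (p ^^ n) y = (p ^^ n) x}"
  proof (rule bij_betwI')
    show "(f x = g x) = (f = g)" if "f \<in> deck n" "g \<in> deck n" for f g
      using deck_eqI that x by blast
    show "f x \<in> {y \<in> X. (p ^^ n) y = (p ^^ n) x}" if "f \<in> deck n" for f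
      using deckD [OF that] x by simp
    show "\<exists>f\<in>deck n. y = f x" if "y \<in> {y \<in> X. (p ^^ n) y = (p ^^ n) x}" for y
    proof -
      have "y \<in> X" "(p ^^ n) x = (p ^^ n) y"
        using that by auto
      then obtain f where "f \<in> deck n" "f x = y"
        using deck_transitive [OF x] by metis
      then show ?thesis by blast
    qed
  qed
  then show "card (deck n) = k ^ n"
    using card_fibre [OF pow_in [OF x]] by (simp add: bij_betw_same_card)
  then show "finite (deck n)"
    using k by (intro card_ge_0_finite) simp
qed

text \<open>The map that a deck transformation \<open>f\<close> induces on the base of the covering \<open>p\<close>. It does not depend on the chosen preimage
(\<open>shift_deck\<close>).\<close>

definition shift :: "('a \<Rightarrow> 'a) \<Rightarrow> 'a \<Rightarrow> 'a" where
  "shift f y = (if y \<in> X then p (f (SOME x. x \<in> X \<and> p x = y)) else y)"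

text \<open>Regularity of \<open>p ^^ n\<close> provides a \<open>g\<close> with \<open>g \<circ> p = p \<circ> f\<close> at one point. Both sides lift \<open>p ^^ Suc n\<close> through \<open>p ^^ n\<close>, so they agree
everywhere.\<close>

lemma shift_deck:
  assumes f: "f \<in> deck (Suc n)"
  shows "shift f \<in> deck n" "\<And>x. x \<in> X \<Longrightarrow> shift f (p x) = p (f x)"
proof -
  obtain x0 where x0: "x0 \<in> X" using neX by blast
  have eq: "(p ^^ n) (p (f x)) = (p ^^ n) (p x)" if "x \<in> X" for x
    using deckD(3) [OF f that] by (simp only: funpow_Suc_right o_apply)
  obtain g where g: "g \<in> deck n" "g (p x0) = p (f x0)"
    using deck_transitive [of "p x0" "p (f x0)" n] eq [OF x0] p_in deckD(2) [OF f] x0 by metis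
  have cp: "continuous_on X p"
    using covering_space_imp_continuous [OF cover [of 1]] by simp
  have pf: "p (f x) = g (p x)" if x: "x \<in> X" for x
  proof (rule lift_unique_on_connected [OF cover [of n] conX, where f = "\<lambda>x. (p ^^ n) (p x)"
        and a = x0 and ?g1.0 = "\<lambda>x. p (f x)" and ?g2.0 = "\<lambda>x. g (p x)"])
    show "continuous_on X (\<lambda>x. p (f x))"
      by (rule continuous_on_compose2 [OF cp deckD(1) [OF f]]) (use deckD(2) [OF f] in auto)
    show "continuous_on X (\<lambda>x. g (p x))"
      by (rule continuous_on_compose2 [OF deckD(1) [OF g(1)] cp]) (use p_in in auto)
  qed (use p_in deckD(2) [OF f] deckD(2,3) [OF g(1)] eq g x x0 in auto)
  have "shift f y = g y" for y
  proof (cases "y \<in> X")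
    case True
    define x where "x = (SOME x. x \<in> X \<and> p x = y)"
    have "\<exists>x. x \<in> X \<and> p x = y"
      using p_onto [OF True] by blast
    then have "x \<in> X \<and> p x = y"
      unfolding x_def by (rule someI_ex)
    then show ?thesis
      using pf True by (auto simp: shift_def x_def)
  next
    case False
    then show ?thesis
      using deckD(4) [OF g(1)] by (simp add: shift_def)
  qed
  then have "shift f = g" by blast
  then show "shift f \<in> deck n" "\<And>x. x \<in> X \<Longrightarrow> shift f (p x) = p (f x)"
    using g(1) pf by auto
qed

lemma in_deck_Suc: "f \<in> deck n \<Longrightarrow> f \<in> deck (Suc n)"
  using deck_mono [of n "Suc n"] by auto

lemma shift_intertwines:
  assumes "f \<in> carrier deck_group" "x \<in> X"
  shows "shift f (p x) = p (f x)"
proof -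
  obtain n where "f \<in> deck n"
    using assms(1) by auto
  then show ?thesis
    using shift_deck(2) [OF in_deck_Suc assms(2)] by blast
qed

lemma shift_in: "f \<in> carrier deck_group \<Longrightarrow> shift f \<in> carrier deck_group"
proof -
  assume "f \<in> carrier deck_group"
  then obtain n where "f \<in> deck n"
    by auto
  then have "shift f \<in> deck n"
    using shift_deck(1) [OF in_deck_Suc] by blast
  then show ?thesis by auto
qed

lemma deck_group_eqI:
  assumes "f \<in> carrier deck_group" "g \<in> carrier deck_group" "\<And>x. x \<in> X \<Longrightarrow> f x = g x"
  shows "f = g"
  using assms deckD(4) by (metis UN_E deck_group_simps(3) ext)

lemma shift_hom: "shift \<in> hom deck_group deck_group"
proof (rule homI)
  interpret group deck_group by (rule group_deck_group)
  fix f g assume fg: "f \<in> carrier deck_group" "g \<in> carrier deck_group"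
  have fgc: "f \<circ> g \<in> carrier deck_group" "shift f \<circ> shift g \<in> carrier deck_group"
    using m_closed [OF fg] m_closed [OF shift_in shift_in, OF fg] by auto
  have "shift (f \<circ> g) = shift f \<circ> shift g"
  proof (rule deck_group_eqI [OF shift_in [OF fgc(1)] fgc(2)])
    fix y assume "y \<in> X"
    then obtain x where x: "x \<in> X" "y = p x"
      using p_onto by blast
    moreover have "g x \<in> X"
      using fg(2) x deckD(2) by auto
    ultimately show "shift (f \<circ> g) y = (shift f \<circ> shift g) y"
      using shift_intertwines [OF fgc(1)] shift_intertwines [OF fg(1)] shift_intertwines [OF fg(2)] by simp
  qed
  then show "shift (f \<otimes>\<^bsub>deck_group\<^esub> g) = shift f \<otimes>\<^bsub>deck_group\<^esub> shift g"
    by simp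
qed (rule shift_in)

text \<open>A preimage of \<open>g\<close> is found by regularity of \<open>p ^^ Suc n\<close>, applied to a point \<open>x\<close> and a point over \<open>g (p x)\<close>.\<close>

lemma shift_onto: "shift ` carrier deck_group = carrier deck_group"
proof
  show "carrier deck_group \<subseteq> shift ` carrier deck_group"
  proof
    fix g assume "g \<in> carrier deck_group"
    then obtain n where g: "g \<in> deck n" by auto
    obtain x where x: "x \<in> X" using neX by blast
    then obtain y where y: "y \<in> X" "p y = g (p x)"
      using p_onto p_in deckD(2) [OF g] by metis
    have "(p ^^ Suc n) x = (p ^^ Suc n) y"
      using deckD(3) [OF g p_in [OF x]] y by (simp only: funpow_Suc_right o_apply)
    then obtain f where f: "f \<in> deck (Suc n)" "f x = y"
      using deck_transitive x y(1) by metis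
    have "shift f = g"
      by (rule deck_eqI [OF shift_deck(1) [OF f(1)] g p_in [OF x]])
        (simp add: shift_deck(2) [OF f(1) x] f y)
    then show "g \<in> shift ` carrier deck_group"
      using f(1) by auto
  qed
qed (use shift_in in blast)

lemma shift_pow:
  assumes f: "f \<in> carrier deck_group"
  shows "(shift ^^ j) f \<in> carrier deck_group" "\<And>x. x \<in> X \<Longrightarrow> (shift ^^ j) f ((p ^^ j) x) = (p ^^ j) (f x)"
proof (induction j)
  case (Suc j)
  {
    case 1
    show ?case using Suc.IH(1) shift_in by simp
  next
    case 2
    then show ?case
      using Suc.IH shift_intertwines pow_in by simp
  }
qed (use f in auto)

lemma shift_pow_kernel: "{f \<in> carrier deck_group. (shift ^^ j) f = id} = deck j"
proof (intro equalityI subsetI)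
  fix f assume "f \<in> {f \<in> carrier deck_group. (shift ^^ j) f = id}"
  then have f: "f \<in> carrier deck_group" "(shift ^^ j) f = id" by auto
  then have "(p ^^ j) (f x) = (p ^^ j) x" if "x \<in> X" for x
    using shift_pow(2) [OF f(1) that, of j] by simp
  then show "f \<in> deck j"
    using f(1) by (auto simp: deck_def)
next
  fix f assume f: "f \<in> deck j"
  then have fc: "f \<in> carrier deck_group" by auto
  have "(shift ^^ j) f = id"
  proof (rule deck_group_eqI [OF shift_pow(1) [OF fc]])
    show "id \<in> carrier deck_group"
      using id_deck by auto
    fix y assume "y \<in> X"
    then obtain x where "x \<in> X" "(p ^^ j) x = y"
      using pow_onto by blast
    then show "(shift ^^ j) f y = id y"
      using shift_pow(2) [OF fc, of x j] deckD(3) [OF f] by simp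
  qed
  with fc show "f \<in> {f \<in> carrier deck_group. (shift ^^ j) f = id}"
    by simp
qed

lemma transports_total:
  assumes "path \<gamma>" "path_image \<gamma> \<subseteq> X" "y \<in> X" "(p ^^ n) y = pathstart \<gamma>"
  shows "\<exists>y'. transports X (p ^^ n) \<gamma> y y'"
  using transports_exists [OF cover assms] by blast

lemma transports_deck:
  assumes "transports X (p ^^ n) \<gamma> y y'" "g \<in> deck n"
  shows "transports X (p ^^ n) \<gamma> (g y) (g y')"
proof -
  obtain \<eta> where \<eta>: "path \<eta>" "path_image \<eta> \<subseteq> X" "\<And>t. t \<in> {0..1} \<Longrightarrow> (p ^^ n) (\<eta> t) = \<gamma> t"
    "pathstart \<eta> = y" "pathfinish \<eta> = y'"
    using assms by (auto simp: transports_def)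
  have "path (g \<circ> \<eta>)"
    using \<eta>(1,2) deckD(1) [OF assms(2)] by (intro path_continuous_image) (auto intro: continuous_on_subset)
  moreover have "path_image (g \<circ> \<eta>) \<subseteq> X"
    using \<eta>(2) deckD(2) [OF assms(2)] by (auto simp: path_image_compose)
  moreover have "(p ^^ n) ((g \<circ> \<eta>) t) = \<gamma> t" if "t \<in> {0..1}" for t
    using \<eta>(2) \<eta>(3) [OF that] deckD(3) [OF assms(2)] that by (simp add: path_image_def image_subset_iff)
  ultimately show ?thesis
    unfolding transports_def using \<eta>(4,5)
    by (intro exI [of _ "g \<circ> \<eta>"]) (auto simp: pathstart_compose pathfinish_compose)
qed

section \<open>Monodromy\<close>

definition monodromy :: "nat \<Rightarrow> 'a \<Rightarrow> (real \<Rightarrow> 'a) \<Rightarrow> 'a \<Rightarrow> 'a" where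
  "monodromy n y \<gamma> = (THE f. f \<in> deck n \<and> transports X (p ^^ n) \<gamma> y (f y))"

definition loop_at :: "'a \<Rightarrow> (real \<Rightarrow> 'a) \<Rightarrow> bool" where
  "loop_at x \<gamma> \<longleftrightarrow> path \<gamma> \<and> path_image \<gamma> \<subseteq> X \<and> pathstart \<gamma> = x \<and> pathfinish \<gamma> = x"

lemma monodromy_eqI:
  assumes "f \<in> deck n" "transports X (p ^^ n) \<gamma> y (f y)"
  shows "monodromy n y \<gamma> = f"
  unfolding monodromy_def
proof (rule the_equality)
  fix g assume "g \<in> deck n \<and> transports X (p ^^ n) \<gamma> y (g y)"
  then show "g = f"
    using assms transports_unique [OF cover] transports_ends(1) deck_eqI by metis
qed (use assms in auto)

lemma monodromy:
  assumes \<gamma>: "loop_at x \<gamma>" and y: "y \<in> X" "(p ^^ n) y = x"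
  shows "monodromy n y \<gamma> \<in> deck n" "transports X (p ^^ n) \<gamma> y (monodromy n y \<gamma> y)"
proof -
  obtain z where z: "transports X (p ^^ n) \<gamma> y z"
    using transports_exists [OF cover, of \<gamma> y n] \<gamma> y unfolding loop_at_def by metis
  then have "z \<in> X" "(p ^^ n) y = (p ^^ n) z"
    using transports_ends [OF z] \<gamma> y by (auto simp: loop_at_def)
  then obtain f where "f \<in> deck n" "f y = z"
    using deck_transitive y(1) by metis
  then show "monodromy n y \<gamma> \<in> deck n" "transports X (p ^^ n) \<gamma> y (monodromy n y \<gamma> y)"
    using monodromy_eqI [of f n \<gamma> y] z by auto
qed

text \<open>Each vertex \<open>s\<close> is joined to the base point by a path \<open>\<tau> s\<close>, which turns every edge into a loop. Let \<open>H\<close> be generated by the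
monodromies of these loops. The points over the vertices that transport along some \<open>\<tau> s\<close> reaches from the \<open>H\<close>-orbit of \<open>y0\<close> form a
stable set, hence are all points over the vertices; over the base point this says that \<open>H\<close> is all of \<open>deck n\<close>.\<close>

theorem finitely_many_loops_generate:
  assumes SP: "transport_graph X S P"
  obtains x0 \<Lambda> where "x0 \<in> X" "finite \<Lambda>" "\<And>\<gamma>. \<gamma> \<in> \<Lambda> \<Longrightarrow> loop_at x0 \<gamma>"
    "\<And>n y0. y0 \<in> X \<Longrightarrow> (p ^^ n) y0 = x0 \<Longrightarrow> deck n \<subseteq> generate deck_group (monodromy n y0 ` \<Lambda>)"
proof -
  interpret G: group deck_group by (rule group_deck_group)
  obtain x0 where x0: "x0 \<in> S" "x0 \<in> X"
    using transport_graphD(2,5) [OF SP] neX by blast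
  have pcS: "path_component X x0 s" if "s \<in> S" for s
  proof -
    \<comment> \<open>for \<open>n = 0\<close> the covering is the identity and stability means closure under the edges themselves\<close>
    let ?T = "{s \<in> S. path_component X x0 s}"
    have "?T = {y \<in> X. (p ^^ 0) y \<in> S}"
    proof (rule stable_set_is_everything [OF SP])
      show "?T \<subseteq> {y \<in> X. (p ^^ 0) y \<in> S}"
        using transport_graphD(2) [OF SP] by auto
      have "path_component X y y' \<and> y \<in> S \<and> y' \<in> S" if "transports X (p ^^ 0) \<pi> y y'" "\<pi> \<in> P" for \<pi> y y'
        using that transports_ends [OF that(1)] transport_graphD(4) [OF SP that(2)]
        by (auto simp: transports_def path_component_def)
      then show "stable 0 P ?T"
        unfolding stable_def by (blast intro: path_component_trans path_component_sym)
      show "?T \<noteq> {}"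
        using x0 path_component_refl by blast
    qed (rule conX)
    then show ?thesis
      using that transport_graphD(2) [OF SP] by auto
  qed
  then obtain \<tau> where \<tau>: "\<And>s. s \<in> S \<Longrightarrow> path (\<tau> s)" "\<And>s. s \<in> S \<Longrightarrow> path_image (\<tau> s) \<subseteq> X"
    "\<And>s. s \<in> S \<Longrightarrow> pathstart (\<tau> s) = x0" "\<And>s. s \<in> S \<Longrightarrow> pathfinish (\<tau> s) = s"
    unfolding path_component_def by metis
  define loop where "loop \<pi> = \<tau> (pathstart \<pi>) +++ (\<pi> +++ reversepath (\<tau> (pathfinish \<pi>)))" for \<pi>
  have loop: "loop_at x0 (loop \<pi>)" if "\<pi> \<in> P" for \<pi>
    using transport_graphD(4) [OF SP that] \<tau> by (auto simp: loop_at_def loop_def path_image_join)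
  show thesis
  proof (rule that [OF x0(2)])
    show "finite (loop ` P)"
      using transport_graphD(3) [OF SP] by simp
    show "loop_at x0 \<gamma>" if "\<gamma> \<in> loop ` P" for \<gamma>
      using that loop by blast
    fix n y0 assume y0: "y0 \<in> X" "(p ^^ n) y0 = x0"
    define H where "H = generate deck_group (monodromy n y0 ` loop ` P)"
    have "monodromy n y0 ` loop ` P \<subseteq> carrier deck_group"
      using monodromy(1) [OF loop y0] by auto
    then interpret H: subgroup H deck_group
      unfolding H_def by (rule G.generate_is_subgroup)
    have start: "\<exists>g\<in>deck n. transports X (p ^^ n) (\<tau> s) (g y0) y"
      if sy: "s \<in> S" "y \<in> X" "(p ^^ n) y = s" for s y
    proof -
      obtain z where z: "transports X (p ^^ n) (reversepath (\<tau> s)) y z"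
        using transports_total [of "reversepath (\<tau> s)" y n] \<tau> [OF sy(1)] sy(2,3) by auto
      then have "(p ^^ n) y0 = (p ^^ n) z" "z \<in> X"
        using transports_ends [OF z] y0 \<tau> [OF sy(1)] by auto
      then obtain g where "g \<in> deck n" "g y0 = z"
        using deck_transitive y0 by metis
      then show ?thesis
        using transports_reverse [OF z] by auto
    qed
    define T where "T = {y \<in> X. (p ^^ n) y \<in> S \<and> (\<exists>g\<in>H \<inter> deck n. transports X (p ^^ n) (\<tau> ((p ^^ n) y)) (g y0) y)}"
    have T_iff: "y \<in> T \<longleftrightarrow> g \<in> H"
      if sg: "s \<in> S" "(p ^^ n) y = s" "g \<in> deck n" "transports X (p ^^ n) (\<tau> s) (g y0) y" for s y g
    proof
      assume "y \<in> T"
      then obtain g1 where "g1 \<in> H \<inter> deck n" "transports X (p ^^ n) (\<tau> s) (g1 y0) y"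
        using sg(2) by (auto simp: T_def)
      then show "g \<in> H"
        using transports_inj [OF cover sg(4)] deck_eqI [OF sg(3), of g1 y0] y0 by auto
    next
      assume "g \<in> H"
      then show "y \<in> T"
        using sg transports_ends(2) [OF sg(4)] by (auto simp: T_def)
    qed
    have T_all: "T = {y \<in> X. (p ^^ n) y \<in> S}"
    proof (rule stable_set_is_everything [OF SP conX])
      show "T \<subseteq> {y \<in> X. (p ^^ n) y \<in> S}"
        by (auto simp: T_def)
      have "y \<in> T \<longleftrightarrow> y' \<in> T" if \<pi>: "\<pi> \<in> P" and t: "transports X (p ^^ n) \<pi> y y'" for \<pi> y y'
      proof -
        have S: "pathstart \<pi> \<in> S" "pathfinish \<pi> \<in> S"
          using transport_graphD(4) [OF SP \<pi>] by auto
        note e = transports_ends [OF t]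
        obtain g where g: "g \<in> deck n" "transports X (p ^^ n) (\<tau> (pathstart \<pi>)) (g y0) y"
          using start S(1) e by blast
        obtain g' where g': "g' \<in> deck n" "transports X (p ^^ n) (\<tau> (pathfinish \<pi>)) (g' y0) y'"
          using start S(2) e by blast
        obtain h where h: "h \<in> deck n" "h \<circ> g = id" "g \<circ> h = id"
          using inverse_deck [OF g(1)] by blast
        have "transports X (p ^^ n) (loop \<pi>) (g y0) (g' y0)"
          unfolding loop_def
          by (intro transports_join [OF g(2)] transports_join [OF t] transports_reverse [OF g'(2)])
        then have "transports X (p ^^ n) (loop \<pi>) (h (g y0)) (h (g' y0))"
          using h(1) by (rule transports_deck)
        then have "monodromy n y0 (loop \<pi>) = h \<circ> g'"
          using fun_cong [OF h(2), of y0] by (intro monodromy_eqI comp_deck h(1) g'(1)) simp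
        then have "h \<circ> g' \<in> monodromy n y0 ` loop ` P"
          using \<pi> by (metis imageI)
        then have hg: "h \<circ> g' \<in> H"
          unfolding H_def by (rule generate.incl)
        \<comment> \<open>\<open>g\<close> and \<open>g'\<close> differ by a generator of \<open>H\<close>, so they lie in \<open>H\<close> together\<close>
        have "g' = g \<circ> (h \<circ> g')"
          using h(3) by (simp add: o_assoc)
        then have "g \<in> H \<Longrightarrow> g' \<in> H"
          using H.m_closed [of g "h \<circ> g'"] hg by simp
        moreover have "g \<in> H" if "g' \<in> H"
        proof -
          have "inv\<^bsub>deck_group\<^esub> (h \<circ> g') \<in> H"
            using hg by (rule H.m_inv_closed)
          then have "g' \<circ> inv\<^bsub>deck_group\<^esub> (h \<circ> g') \<in> H"
            using H.m_closed that by simp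
          moreover have "g' \<circ> inv\<^bsub>deck_group\<^esub> (h \<circ> g') = g"
          proof -
            have "g' = g \<otimes>\<^bsub>deck_group\<^esub> (h \<circ> g')"
              using \<open>g' = g \<circ> (h \<circ> g')\<close> by simp
            then show ?thesis
              using G.inv_solve_right' [of g g' "h \<circ> g'"] g g' hg H.mem_carrier by auto
          qed
          ultimately show ?thesis by simp
        qed
        ultimately show ?thesis
          using T_iff [OF S(1) _ g] T_iff [OF S(2) _ g'] e by auto
      qed
      then show "stable n P T"
        unfolding stable_def by blast
      obtain y where y: "transports X (p ^^ n) (\<tau> x0) y0 y"
        using transports_total [of "\<tau> x0" y0 n] \<tau> [OF x0(1)] y0 by auto
      then have "y \<in> T"
        using T_iff [OF x0(1) _ id_deck, of y] y transports_ends [OF y] \<tau> [OF x0(1)] H.one_closed by auto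
      then show "T \<noteq> {}" by blast
    qed
    show "deck n \<subseteq> generate deck_group (monodromy n y0 ` loop ` P)"
    proof
      fix g assume g: "g \<in> deck n"
      then have "g y0 \<in> X" "(p ^^ n) (g y0) = x0"
        using deckD [OF g] y0 by auto
      then obtain y where y: "transports X (p ^^ n) (\<tau> x0) (g y0) y"
        using transports_total [of "\<tau> x0" "g y0" n] \<tau> [OF x0(1)] by auto
      then have "(p ^^ n) y = x0" "y \<in> X"
        using transports_ends [OF y] \<tau> [OF x0(1)] by auto
      then have "y \<in> T"
        using T_all x0 by simp
      then show "g \<in> generate deck_group (monodromy n y0 ` loop ` P)"
        using T_iff [OF x0(1) \<open>(p ^^ n) y = x0\<close> g y] by (simp add: H_def)
    qed
  qed
qed

theorem comm_group_deck_group: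
  assumes SP: "transport_graph X S P"
  shows "comm_group deck_group"
proof -
  obtain x0 \<Lambda> where \<Lambda>: "x0 \<in> X" "finite \<Lambda>" "\<And>\<gamma>. \<gamma> \<in> \<Lambda> \<Longrightarrow> loop_at x0 \<gamma>"
    "\<And>n y0. y0 \<in> X \<Longrightarrow> (p ^^ n) y0 = x0 \<Longrightarrow> deck n \<subseteq> generate deck_group (monodromy n y0 ` \<Lambda>)"
    using finitely_many_loops_generate [OF SP] by metis
  have "uniformly_generated deck_group (card \<Lambda>)"
    unfolding uniformly_generated_def
  proof (intro allI impI)
    fix A assume A: "A \<subseteq> carrier deck_group" "finite A"
    have "\<exists>n. A \<subseteq> deck n"
      using A(2,1)
    proof (induction A rule: finite_induct)
      case (insert f A)
      then obtain m n where "A \<subseteq> deck m" "f \<in> deck n" by auto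
      then have "insert f A \<subseteq> deck (max m n)"
        using deck_mono [of m "max m n"] deck_mono [of n "max m n"] by auto
      then show ?case by blast
    qed auto
    then obtain n where n: "A \<subseteq> deck n" by blast
    obtain y0 where y0: "y0 \<in> X" "(p ^^ n) y0 = x0"
      using pow_onto \<Lambda>(1) by blast
    show "\<exists>B\<subseteq>carrier deck_group. finite B \<and> card B \<le> card \<Lambda> \<and> A \<subseteq> generate deck_group B"
      using monodromy(1) [OF \<Lambda>(3) y0] \<Lambda>(2) \<Lambda>(4) [OF y0] n
      by (intro exI [of _ "monodromy n y0 ` \<Lambda>"]) (auto intro: card_image_le)
  qed
  then show ?thesis
  proof (rule uniformly_generated_imp_comm_group [OF group_deck_group _ shift_hom shift_onto])
    show "\<exists>j. (shift ^^ j) g = \<one>\<^bsub>deck_group\<^esub>" if "g \<in> carrier deck_group" for g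
      using that shift_pow_kernel by (simp, blast)
    show "finite {g \<in> carrier deck_group. (shift ^^ j) g = \<one>\<^bsub>deck_group\<^esub>}" for j
      using shift_pow_kernel [of j] finite_deck by (simp only: deck_group_simps(2))
  qed
qed

end

section \<open>Torsion in homology\<close>

lemma homology_class_hom:
  "homologous_rel_set n X {} \<in> hom (relcycle_group n X {}) (homology_group (int n) X)"
  using normal.r_coset_hom_Mod [OF normal_subgroup_singular_relboundary_relcycle [of n X "{}"]]
  by (simp add: right_coset_singular_relboundary nontrivial_relative_homology_group)

lemma relcycle_group_int_pow:
  assumes "singular_relcycle n X {} c"
  shows "c [^]\<^bsub>relcycle_group n X {}\<^esub> (m::int) = frag_cmul m c"
proof -
  have "c \<in> carrier (relcycle_group n X {})"
    using assms by simp
  then have "c [^]\<^bsub>relcycle_group n X {}\<^esub> m = c [^]\<^bsub>chain_group n X\<^esub> m"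
    unfolding relcycle_group_def by (rule group.int_pow_subgroup_generated [OF group_chain_group])
  also have "\<dots> = frag_cmul m c"
    using assms unfolding chain_group_def
    by (intro int_pow_free_Abelian_group) (simp add: singular_cycle singular_chain_def)
  finally show ?thesis .
qed

lemma int_independent_singleton:
  assumes "comm_group G" "b \<in> carrier G" "\<And>m::int. b [^]\<^bsub>G\<^esub> m = \<one>\<^bsub>G\<^esub> \<Longrightarrow> m = 0"
  shows "int_independent G {b}"
proof -
  interpret comm_group G by fact
  have "finprod G (\<lambda>x. x [^]\<^bsub>G\<^esub> c x) {b} = b [^]\<^bsub>G\<^esub> c b" for c :: "'a \<Rightarrow> int"
    using assms(2) by (subst finprod_insert) auto
  then show ?thesis
    using assms by (auto simp: int_independent_def)
qed

text \<open>An element of infinite order is an independent set with one element.\<close>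

lemma torsion_if_betti_number_0:
  assumes b: "betti_number n X = 0" and c: "singular_relcycle n X {} c"
  obtains m :: nat where "m > 0" "singular_relboundary n X {} (frag_cmul (int m) c)"
proof -
  let ?G = "homology_group (int n) X" and ?b = "homologous_rel_set n X {} c"
  have bG: "?b \<in> carrier ?G"
    using c by (auto simp: carrier_relative_homology_group)
  have "\<not> int_independent ?G {?b}"
  proof
    assume "int_independent ?G {?b}"
    then have "enat (card {?b}) \<le> abelian_group_rank ?G"
      unfolding abelian_group_rank_def by (intro SUP_upper) simp
    then show False
      using b by (simp add: betti_number_def zero_enat_def)
  qed
  then obtain m :: int where m: "m \<noteq> 0" "?b [^]\<^bsub>?G\<^esub> m = \<one>\<^bsub>?G\<^esub>"
    using int_independent_singleton [OF abelian_relative_homology_group bG] by blast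
  have "homologous_rel_set n X {} (frag_cmul m c) = ?b [^]\<^bsub>?G\<^esub> m"
    using hom_int_pow [OF homology_class_hom, of c n X m] c
    by (simp add: relcycle_group_int_pow)
  then have bd: "singular_relboundary n X {} (frag_cmul m c)"
    using m(2) by (simp add: homologous_rel_set_eq_relboundary)
  have "singular_relboundary n X {} (frag_cmul \<bar>m\<bar> c)"
    using singular_relboundary_cmul [OF bd, of "sgn m"] by (simp add: abs_sgn mult.commute)
  then show thesis
    using m(1) by (intro that [of "nat \<bar>m\<bar>"]) auto
qed

text \<open>Every element of the subgroup is a product of powers of the generators with exponents below their orders.\<close>

lemma (in comm_group) card_generate_torsion:
  fixes a :: "'c \<Rightarrow> 'a"
  assumes I: "finite I" and a: "\<And>i. i \<in> I \<Longrightarrow> a i \<in> carrier G"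
    and m: "\<And>i. i \<in> I \<Longrightarrow> m i > (0::nat)" "\<And>i. i \<in> I \<Longrightarrow> a i [^] m i = \<one>"
    and S: "S \<subseteq> generate G (a ` I)"
  shows "card S \<le> (\<Prod>i\<in>I. m i)"
proof -
  define F where "F c = (\<Otimes>i\<in>I. a i [^] c i)" for c :: "'c \<Rightarrow> nat"
  have aI: "(\<lambda>i. a i [^] c i) \<in> I \<rightarrow> carrier G" for c :: "'c \<Rightarrow> nat"
    using a by auto
  have mult: "F c \<otimes> F d = F (\<lambda>i. c i + d i)" for c d
  proof -
    have "F c \<otimes> F d = (\<Otimes>i\<in>I. a i [^] c i \<otimes> a i [^] d i)"
      unfolding F_def by (rule finprod_multf [OF aI aI, symmetric])
    also have "\<dots> = F (\<lambda>i. c i + d i)"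
      unfolding F_def by (rule finprod_cong') (use a in \<open>auto simp: nat_pow_mult\<close>)
    finally show ?thesis .
  qed
  have single: "F (\<lambda>j. if j = i then e else 0) = a i [^] e" if "i \<in> I" for i e
  proof -
    have "F (\<lambda>j. if j = i then e else 0) = (\<Otimes>j\<in>I. if j = i then a j [^] e else \<one>)"
      unfolding F_def by (rule finprod_cong') (use a in auto)
    also have "\<dots> = a i [^] e"
      using finprod_singleton_swap [OF that I, of "\<lambda>j. a j [^] e"] a by auto
    finally show ?thesis .
  qed
  have "g \<in> range F" if "g \<in> generate G (a ` I)" for g
    using that
  proof (induction rule: generate.induct)
    case one
    have "F (\<lambda>_. 0) = \<one>"
      by (simp add: F_def)
    then show ?case by (metis rangeI)
  next
    case (incl h)
    then obtain i where "i \<in> I" "h = a i" by blast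
    then show ?case
      using single [of i 1] a by (metis nat_pow_eone rangeI)
  next
    case (inv h)
    then obtain i where i: "i \<in> I" "h = a i" by blast
    have "a i [^] (m i - 1) \<otimes> a i = \<one>"
      using m [OF i(1)] a [OF i(1)] by (simp flip: nat_pow_Suc)
    then have "inv h = a i [^] (m i - 1)"
      using i a [OF i(1)] by (intro inv_equality) auto
    then show ?case
      using single [OF i(1), of "m i - 1"] by (metis rangeI)
  next
    case (eng h1 h2)
    then show ?case
      using mult by (metis (no_types, lifting) imageE rangeI)
  qed
  moreover have "F c \<in> F ` (\<Pi>\<^sub>E i\<in>I. {..<m i})" for c
  proof -
    have "a i [^] c i = a i [^] (c i mod m i)" if "i \<in> I" for i
    proof -
      have "a i [^] c i = a i [^] (m i * (c i div m i) + c i mod m i)"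
        by simp
      also have "\<dots> = (a i [^] m i) [^] (c i div m i) \<otimes> a i [^] (c i mod m i)"
        using a [OF that] by (simp only: nat_pow_mult nat_pow_pow)
      also have "\<dots> = a i [^] (c i mod m i)"
        using m [OF that] a [OF that] by simp
      finally show ?thesis .
    qed
    then have "F c = F (restrict (\<lambda>i. c i mod m i) I)"
      unfolding F_def using a by (intro finprod_cong') auto
    moreover have "restrict (\<lambda>i. c i mod m i) I \<in> (\<Pi>\<^sub>E i\<in>I. {..<m i})"
      using m by auto
    ultimately show ?thesis by blast
  qed
  ultimately have "S \<subseteq> F ` (\<Pi>\<^sub>E i\<in>I. {..<m i})"
    using S by blast
  moreover have fin: "finite (\<Pi>\<^sub>E i\<in>I. {..<m i})"
    using I by (simp add: finite_PiE)
  ultimately have "card S \<le> card (F ` (\<Pi>\<^sub>E i\<in>I. {..<m i}))"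
    by (intro card_mono) auto
  also have "\<dots> \<le> card (\<Pi>\<^sub>E i\<in>I. {..<m i})"
    by (rule card_image_le [OF fin])
  also have "\<dots> = (\<Prod>i\<in>I. m i)"
    using I by (simp add: card_PiE)
  finally show ?thesis .
qed

text \<open>The path from the vertex 0 to the vertex 1 of a singular 1-simplex; \<open>path_simplex\<close> goes the other way.\<close>

definition edge_path :: "((nat \<Rightarrow> real) \<Rightarrow> 'a) \<Rightarrow> real \<Rightarrow> 'a" where
  "edge_path \<sigma> t = \<sigma> (\<lambda>j. if j = 0 then 1 - t else if j = 1 then t else 0)"

definition path_simplex :: "(real \<Rightarrow> 'a) \<Rightarrow> (nat \<Rightarrow> real) \<Rightarrow> 'a" where
  "path_simplex \<gamma> = restrict (\<lambda>x. \<gamma> (x 1)) (standard_simplex 1)"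

lemma edge_point_in_simplex:
  "t \<in> {0..1} \<Longrightarrow> (\<lambda>j. if j = 0 then 1 - t else if j = 1 then t else 0) \<in> standard_simplex 1"
  by (auto simp: standard_simplex_def)

lemma standard_simplex_1D:
  assumes "x \<in> standard_simplex 1"
  shows "x 1 \<in> {0..1}"
  using assms by (auto simp: standard_simplex_def)

lemma edge_path_path_simplex:
  "t \<in> {0..1} \<Longrightarrow> edge_path (path_simplex \<gamma>) t = \<gamma> t"
  using edge_point_in_simplex [of t] by (simp add: edge_path_def path_simplex_def)

lemma singular_simplex_iff:
  "singular_simplex n (top_of_set X) \<sigma> \<longleftrightarrow> continuous_on (standard_simplex n) \<sigma> \<and>
     \<sigma> \<in> standard_simplex n \<rightarrow> X \<and> \<sigma> \<in> extensional (standard_simplex n)"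
  by (auto simp: singular_simplex_def euclidean_product_topology)

lemma continuous_on_edge:
  "continuous_on {0..1} (\<lambda>t j. if j = (0::nat) then 1 - t else if j = 1 then t else (0::real))"
proof (rule continuous_on_coordinatewise_then_product)
  show "continuous_on {0..1} (\<lambda>t. if j = (0::nat) then 1 - t else if j = 1 then t else (0::real))" for j
    by (cases "j = 0"; cases "j = 1") (auto intro!: continuous_intros)
qed

lemma edge_path_properties:
  assumes "singular_simplex 1 (top_of_set X) \<sigma>"
  shows "path (edge_path \<sigma>)" "path_image (edge_path \<sigma>) \<subseteq> X"
proof -
  have *: "continuous_on (standard_simplex 1) \<sigma>" "\<sigma> \<in> standard_simplex 1 \<rightarrow> X"
    using assms unfolding singular_simplex_iff by blast+
  show "path (edge_path \<sigma>)"
    unfolding path_def edge_path_def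
    by (rule continuous_on_compose2 [OF *(1) continuous_on_edge]) (use edge_point_in_simplex in blast)
  show "path_image (edge_path \<sigma>) \<subseteq> X"
    using *(2) edge_point_in_simplex by (auto simp: path_image_def edge_path_def)
qed

lemma singular_simplex_path_simplex:
  assumes "path \<gamma>" "path_image \<gamma> \<subseteq> X"
  shows "singular_simplex 1 (top_of_set X) (path_simplex \<gamma>)"
proof -
  have "continuous_on (standard_simplex 1) (\<lambda>x. \<gamma> (x 1))"
  proof (rule continuous_on_compose2 [where g = \<gamma> and f = "\<lambda>x. x 1"])
    show "continuous_on {0..1} \<gamma>"
      using assms(1) by (simp add: path_def)
    show "continuous_on (standard_simplex 1) (\<lambda>x. x 1 :: real)"
      by (rule continuous_on_subset [OF continuous_on_product_coordinates subset_UNIV])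
  qed (use standard_simplex_1D in blast)
  moreover have "\<gamma> (x 1) \<in> X" if "x \<in> standard_simplex 1" for x
    using standard_simplex_1D [OF that] assms(2) by (auto simp: path_image_def)
  ultimately show ?thesis
    unfolding singular_simplex_iff path_simplex_def by (auto cong: continuous_on_cong)
qed

lemma relcycle_path_simplex:
  assumes "path \<gamma>" "path_image \<gamma> \<subseteq> X" "pathstart \<gamma> = pathfinish \<gamma>"
  shows "singular_relcycle 1 (top_of_set X) {} (frag_of (path_simplex \<gamma>))"
proof -
  let ?e = "(\<lambda>j. if j = 0 then 1 else 0) :: nat \<Rightarrow> real"
  have "singular_face 1 0 (path_simplex \<gamma>) = singular_face 1 1 (path_simplex \<gamma>)"
  proof
    fix x
    show "singular_face 1 0 (path_simplex \<gamma>) x = singular_face 1 1 (path_simplex \<gamma>) x"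
    proof (cases "x \<in> standard_simplex 0")
      case True
      then have x: "x = ?e" by (simp add: standard_simplex_0)
      have "simplical_face 0 ?e \<in> standard_simplex 1" "simplical_face 1 ?e \<in> standard_simplex 1"
        using simplical_face_in_standard_simplex [of 1 0 ?e] simplical_face_in_standard_simplex [of 1 1 ?e]
        by auto
      moreover have "simplical_face 0 ?e 1 = 1" "simplical_face 1 ?e 1 = 0"
        by (auto simp: simplical_face_def)
      ultimately show ?thesis
        using True assms(3) by (simp add: singular_face_def path_simplex_def x pathstart_def pathfinish_def)
    qed (simp add: singular_face_def)
  qed
  then have "chain_boundary 1 (frag_of (path_simplex \<gamma>)) = 0"
    by (simp add: chain_boundary_of)
  then show ?thesis
    using singular_simplex_path_simplex [OF assms(1,2)] by (simp add: singular_cycle singular_chain_of)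
qed

lemma simplex_2_contraction:
  "contraction (standard_simplex 2) (\<lambda>j. if j = 0 then 1 else 0)
     (\<lambda>w i. (1 - fst w) * (if i = 0 then 1 else 0) + fst w * snd w i)"
proof -
  let ?e = "(\<lambda>j. if j = 0 then 1 else 0) :: nat \<Rightarrow> real"
  have e: "?e \<in> standard_simplex 2" by simp
  have "continuous_on ({0..1} \<times> standard_simplex 2)
      (\<lambda>w i. (1 - fst w) * ?e i + fst w * snd w i)"
    by (intro continuous_on_coordinatewise_then_product continuous_intros
        continuous_on_product_then_coordinatewise [OF continuous_on_snd])
  moreover have "(\<lambda>w i. (1 - fst w) * ?e i + fst w * snd w i) \<in> {0..1} \<times> standard_simplex 2 \<rightarrow> standard_simplex 2"
    using convex_standard_simplex [OF e] by auto
  ultimately show ?thesis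
    using e unfolding contraction_def by (auto simp: algebra_simps)
qed

text \<open>A lift of the simplex restricts to a lift of each of its edges.\<close>

lemma edge_path_face_transport:
  assumes \<omega>: "\<omega>' \<in> standard_simplex 2 \<rightarrow> X" "continuous_on (standard_simplex 2) \<omega>'"
      "\<And>x. x \<in> standard_simplex 2 \<Longrightarrow> q (\<omega>' x) = \<omega> x" and k: "k \<le> 2"
  shows "transports X q (edge_path (singular_face 2 k \<omega>))
    (\<omega>' (simplical_face k (\<lambda>j. if j = 0 then 1 else 0)))
    (\<omega>' (simplical_face k (\<lambda>j. if j = 1 then 1 else 0)))"
proof -
  define l where "l t = simplical_face k (\<lambda>j. if j = (0::nat) then 1 - t else if j = 1 then t else 0)" for t :: real
  have l: "l t \<in> standard_simplex 2" if "t \<in> {0..1}" for t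
    using simplical_face_in_standard_simplex [of 2 k] k edge_point_in_simplex [OF that] by (simp add: l_def)
  have cl: "continuous_on {0..1} l"
  proof (rule continuous_on_coordinatewise_then_product)
    fix i
    define E where "E t j = (if j = (0::nat) then 1 - t else if j = 1 then t else (0::real))" for t j
    have E: "continuous_on {0..1} (\<lambda>t. E t j)" for j
      unfolding E_def using continuous_on_edge by (rule continuous_on_product_then_coordinatewise)
    have eq: "(\<lambda>t. l t i) = (if i < k then (\<lambda>t. E t i) else if i = k then (\<lambda>t. 0) else (\<lambda>t. E t (i - 1)))"
      by (auto simp: l_def simplical_face_def E_def)
    show "continuous_on {0..1} (\<lambda>t. l t i)"
      unfolding eq using E [of i] E [of "i - 1"] by (auto simp only: continuous_on_const split: if_split)
  qed
  show ?thesis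
    unfolding transports_def
  proof (intro exI conjI ballI)
    show "path (\<omega>' \<circ> l)"
      unfolding path_def
      by (rule continuous_on_compose [OF cl continuous_on_subset [OF \<omega>(2)]]) (use l in blast)
    show "path_image (\<omega>' \<circ> l) \<subseteq> X"
      using l \<omega>(1) by (auto simp: path_image_def)
    show "q ((\<omega>' \<circ> l) t) = edge_path (singular_face 2 k \<omega>) t" if "t \<in> {0..1}" for t
      using \<omega>(3) [OF l [OF that]] edge_point_in_simplex [OF that]
      by (simp add: edge_path_def singular_face_def l_def)
    have "l 0 = simplical_face k (\<lambda>j. if j = 0 then 1 else 0)" "l 1 = simplical_face k (\<lambda>j. if j = 1 then 1 else 0)"
      by (auto simp: l_def intro!: arg_cong [of _ _ "simplical_face k"])
    then show "pathstart (\<omega>' \<circ> l) = \<omega>' (simplical_face k (\<lambda>j. if j = 0 then 1 else 0))"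
      "pathfinish (\<omega>' \<circ> l) = \<omega>' (simplical_face k (\<lambda>j. if j = 1 then 1 else 0))"
      by (auto simp: pathstart_def pathfinish_def)
  qed
qed

section \<open>Monodromy as a singular cocycle\<close>

context self_cover_tower
begin

text \<open>An arbitrary, possibly discontinuous, section of \<open>p ^^ n\<close>. It is only used to compare the endpoints of lifted edges.\<close>

definition lift_point :: "nat \<Rightarrow> 'a \<Rightarrow> 'a" where
  "lift_point n x = (SOME y. y \<in> X \<and> (p ^^ n) y = x)"

lemma lift_point: "x \<in> X \<Longrightarrow> lift_point n x \<in> X" "x \<in> X \<Longrightarrow> (p ^^ n) (lift_point n x) = x"
  using someI_ex [of "\<lambda>y. y \<in> X \<and> (p ^^ n) y = x"] pow_onto [of x n]
  unfolding lift_point_def by blast+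

text \<open>The monodromy of a path that need not be closed: the deck transformation that compares the endpoint of a lift with the section.\<close>

definition holonomy :: "nat \<Rightarrow> (real \<Rightarrow> 'a) \<Rightarrow> 'a \<Rightarrow> 'a" where
  "holonomy n \<gamma> = (SOME f. f \<in> deck n \<and>
     transports X (p ^^ n) \<gamma> (lift_point n (pathstart \<gamma>)) (f (lift_point n (pathfinish \<gamma>))))"

lemma holonomy:
  assumes "path \<gamma>" "path_image \<gamma> \<subseteq> X"
  shows "holonomy n \<gamma> \<in> deck n"
    "transports X (p ^^ n) \<gamma> (lift_point n (pathstart \<gamma>)) (holonomy n \<gamma> (lift_point n (pathfinish \<gamma>)))"
proof -
  have X: "pathstart \<gamma> \<in> X" "pathfinish \<gamma> \<in> X"
    using assms(2) by auto
  obtain z where z: "transports X (p ^^ n) \<gamma> (lift_point n (pathstart \<gamma>)) z"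
    using transports_total [OF assms] lift_point [OF X(1)] by metis
  obtain f where "f \<in> deck n" "f (lift_point n (pathfinish \<gamma>)) = z"
    using deck_transitive [of "lift_point n (pathfinish \<gamma>)" z n] lift_point [OF X(2)] transports_ends [OF z]
    by metis
  then have "\<exists>f. f \<in> deck n \<and>
     transports X (p ^^ n) \<gamma> (lift_point n (pathstart \<gamma>)) (f (lift_point n (pathfinish \<gamma>)))"
    using z by blast
  from someI_ex [OF this] show "holonomy n \<gamma> \<in> deck n"
    "transports X (p ^^ n) \<gamma> (lift_point n (pathstart \<gamma>)) (holonomy n \<gamma> (lift_point n (pathfinish \<gamma>)))"
    unfolding holonomy_def by blast+
qed

text \<open>Once the lifted endpoints of a path are compared with the section by \<open>g\<close> and \<open>g'\<close>, the holonomy is a quotient of these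
two elements. Along the edges of a simplex such quotients telescope.\<close>

lemma holonomy_coboundary:
  assumes "path \<gamma>" "path_image \<gamma> \<subseteq> X" and t: "transports X (p ^^ n) \<gamma> y y'"
    and g: "g \<in> deck n" "g (lift_point n (pathstart \<gamma>)) = y"
    and g': "g' \<in> deck n" "g' (lift_point n (pathfinish \<gamma>)) = y'"
  shows "g' = g \<circ> holonomy n \<gamma>"
proof -
  note h = holonomy [OF assms(1,2), of n]
  have "transports X (p ^^ n) \<gamma> y (g (holonomy n \<gamma> (lift_point n (pathfinish \<gamma>))))"
    using transports_deck [OF h(2) g(1)] g(2) by simp
  then have "y' = g (holonomy n \<gamma> (lift_point n (pathfinish \<gamma>)))"
    using transports_unique [OF cover t] by simp
  moreover have "pathfinish \<gamma> \<in> X"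
    using assms(2) by auto
  ultimately show ?thesis
    using deck_eqI [OF g'(1) comp_deck [OF g(1) h(1)], of "lift_point n (pathfinish \<gamma>)"] lift_point g'(2)
    by simp
qed

text \<open>The cocycle identity. A lift of the 2-simplex makes the holonomies of its three edges the quotients of the
comparison elements at its three vertices.\<close>

lemma holonomy_2_simplex:
  fixes n :: nat
  assumes \<omega>: "singular_simplex 2 (top_of_set X) \<omega>"
  defines "c \<equiv> \<lambda>k. holonomy n (edge_path (singular_face 2 k \<omega>))"
  shows "c 1 = c 2 \<circ> c 0"
proof -
  have \<omega>': "continuous_on (standard_simplex 2) \<omega>" "\<omega> \<in> standard_simplex 2 \<rightarrow> X"
    using \<omega> unfolding singular_simplex_iff by blast+
  let ?e = "\<lambda>i j. if j = (i::nat) then 1 else (0::real)"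
  have e0: "?e 0 \<in> standard_simplex 2" by simp
  then have "\<omega> (?e 0) \<in> X" using \<omega>'(2) by blast
  then obtain y where "y \<in> X" "(p ^^ n) y = \<omega> (?e 0)"
    using pow_onto by blast
  then obtain l where l: "continuous_on (standard_simplex 2) l" "l \<in> standard_simplex 2 \<rightarrow> X"
    "\<And>x. x \<in> standard_simplex 2 \<Longrightarrow> (p ^^ n) (l x) = \<omega> x"
    using covering_space_lift_from_centre [OF cover simplex_2_contraction \<omega>'] by metis
  define v where "v i = l (?e i)" for i
  have face: "simplical_face 0 (?e 0) = ?e 1" "simplical_face 0 (?e 1) = ?e 2"
    "simplical_face 1 (?e 0) = ?e 0" "simplical_face 1 (?e 1) = ?e 2"
    "simplical_face 2 (?e 0) = ?e 0" "simplical_face 2 (?e 1) = ?e 1"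
    by (auto simp: simplical_face_def fun_eq_iff)
  have t: "transports X (p ^^ n) (edge_path (singular_face 2 0 \<omega>)) (v 1) (v 2)"
    "transports X (p ^^ n) (edge_path (singular_face 2 1 \<omega>)) (v 0) (v 2)"
    "transports X (p ^^ n) (edge_path (singular_face 2 2 \<omega>)) (v 0) (v 1)"
    using edge_path_face_transport [where q = "p ^^ n" and \<omega> = \<omega>, OF l(2,1,3), of 0]
      edge_path_face_transport [where q = "p ^^ n" and \<omega> = \<omega>, OF l(2,1,3), of 1]
      edge_path_face_transport [where q = "p ^^ n" and \<omega> = \<omega>, OF l(2,1,3), of 2]
    unfolding face v_def by simp_all
  have "\<exists>g \<in> deck n. g (lift_point n ((p ^^ n) (v i))) = v i" if "i \<le> 2" for i
  proof -
    have "v i \<in> X"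
      using l(2) that by (auto simp: v_def)
    then show ?thesis
      using deck_transitive [of "lift_point n ((p ^^ n) (v i))" "v i" n] lift_point pow_in by metis
  qed
  then obtain g where g: "\<And>i. i \<le> 2 \<Longrightarrow> g i \<in> deck n"
    "\<And>i. i \<le> 2 \<Longrightarrow> g i (lift_point n ((p ^^ n) (v i))) = v i"
    by metis
  have edge: "path (edge_path (singular_face 2 k \<omega>))" "path_image (edge_path (singular_face 2 k \<omega>)) \<subseteq> X"
    if "k \<le> 2" for k
    using edge_path_properties [of X "singular_face 2 k \<omega>"] singular_simplex_singular_face [OF \<omega>, of k] that
    by auto
  have 1: "g 2 = g 1 \<circ> c 0"
    unfolding c_def
    by (rule holonomy_coboundary [OF edge t(1)])
      (use g(1) [of 1] g(1) [of 2] g(2) [of 1] g(2) [of 2]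
        transports_ends [OF t(1)] in simp_all)
  have 2: "g 2 = g 0 \<circ> c 1"
    unfolding c_def
    by (rule holonomy_coboundary [OF edge t(2)])
      (use g(1) [of 0] g(1) [of 2] g(2) [of 0] g(2) [of 2]
        transports_ends [OF t(2)] in simp_all)
  have 3: "g 1 = g 0 \<circ> c 2"
    unfolding c_def
    by (rule holonomy_coboundary [OF edge t(3)])
      (use g(1) [of 0] g(1) [of 1] g(2) [of 0] g(2) [of 1]
        transports_ends [OF t(3)] in simp_all)
  obtain h where h: "h \<circ> g 0 = id"
    using inverse_deck [OF g(1) [of 0]] by auto
  have "h \<circ> g 2 = c 1"
    using 2 h by (simp add: o_assoc)
  moreover have "h \<circ> g 2 = c 2 \<circ> c 0"
    using 1 3 h by (simp add: o_assoc)
  ultimately show ?thesis by simp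
qed

lemma holonomy_path_simplex:
  assumes \<gamma>: "loop_at x \<gamma>"
  shows "holonomy n (edge_path (path_simplex \<gamma>)) = monodromy n (lift_point n x) \<gamma>"
proof -
  have \<gamma>': "path \<gamma>" "path_image \<gamma> \<subseteq> X" "pathstart \<gamma> = x" "pathfinish \<gamma> = x"
    using \<gamma> by (auto simp: loop_at_def)
  let ?e = "edge_path (path_simplex \<gamma>)"
  have eq: "?e t = \<gamma> t" if "t \<in> {0..1}" for t
    using edge_path_path_simplex [OF that] .
  then have ends: "pathstart ?e = x" "pathfinish ?e = x"
    using \<gamma>' by (auto simp: pathstart_def pathfinish_def)
  note e = edge_path_properties [OF singular_simplex_path_simplex [OF \<gamma>'(1,2)]]
  have "transports X (p ^^ n) \<gamma> (lift_point n x) (holonomy n ?e (lift_point n x))"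
    using holonomy(2) [OF e, of n] unfolding ends transports_def using eq by auto
  then show ?thesis
    using monodromy_eqI holonomy(1) [OF e] by metis
qed

text \<open>As \<open>deck_group\<close> is abelian, the holonomy of edges extends to a homomorphism on singular 1-chains, and by the cocycle identity it kills
boundaries. So a multiple of a loop that bounds has trivial image.\<close>

theorem monodromy_torsion:
  assumes comm: "comm_group deck_group" and \<gamma>: "loop_at x \<gamma>"
    and bd: "singular_relboundary 1 (top_of_set X) {} (frag_cmul (int m) (frag_of (path_simplex \<gamma>)))"
  shows "monodromy n (lift_point n x) \<gamma> [^]\<^bsub>deck_group\<^esub> m = \<one>\<^bsub>deck_group\<^esub>"
proof -
  interpret comm_group deck_group by (rule comm)
  let ?S1 = "singular_simplex_set 1 (top_of_set X)"
  let ?C = "chain_group 1 (top_of_set X)"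
  have hol: "holonomy n (edge_path \<sigma>) \<in> carrier deck_group" if "singular_simplex 1 (top_of_set X) \<sigma>" for \<sigma>
    using holonomy(1) [OF edge_path_properties [OF that]] by auto
  obtain h where h: "h \<in> hom ?C deck_group"
    "\<And>\<sigma>. singular_simplex 1 (top_of_set X) \<sigma> \<Longrightarrow> h (frag_of \<sigma>) = holonomy n (edge_path \<sigma>)"
    using free_Abelian_group_universal [of "\<lambda>\<sigma>. holonomy n (edge_path \<sigma>)" ?S1] hol
    unfolding chain_group_def by (metis (no_types, lifting) image_subsetI mem_Collect_eq)
  interpret h: group_hom ?C deck_group h
    using h(1) by (simp add: group_hom_def group_hom_axioms_def)
  have hadd: "h (a + b) = h a \<otimes>\<^bsub>deck_group\<^esub> h b"
    if "singular_chain 1 (top_of_set X) a" "singular_chain 1 (top_of_set X) b" for a b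
    using h.hom_mult [of a b] that by simp
  have hdiff: "h (a - b) = h a \<otimes>\<^bsub>deck_group\<^esub> inv\<^bsub>deck_group\<^esub> (h b)"
    if "singular_chain 1 (top_of_set X) a" "singular_chain 1 (top_of_set X) b" for a b
  proof -
    have "inv\<^bsub>?C\<^esub> b = - b"
      using that(2) by (simp add: singular_chain_def)
    then have "h (- b) = inv\<^bsub>deck_group\<^esub> (h b)"
      using h.hom_inv [of b] that(2) by simp
    then show ?thesis
      using hadd [of a "- b"] that by (simp add: singular_chain_minus)
  qed
  have bd0: "h (chain_boundary 2 d) = \<one>\<^bsub>deck_group\<^esub>" if d: "singular_chain 2 (top_of_set X) d" for d
  proof -
    have "Poly_Mapping.keys d \<subseteq> singular_simplex_set 2 (top_of_set X)"
      using d by (simp add: singular_chain_def)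
    then have "singular_chain 1 (top_of_set X) (chain_boundary 2 d) \<and> h (chain_boundary 2 d) = \<one>\<^bsub>deck_group\<^esub>"
    proof (induction d rule: frag_induction)
      case zero
      then show ?case
        using h.hom_one by simp
    next
      case (one \<omega>)
      then have \<omega>: "singular_simplex 2 (top_of_set X) \<omega>" by simp
      define \<sigma> where "\<sigma> k = singular_face 2 k \<omega>" for k
      have \<sigma>: "singular_simplex 1 (top_of_set X) (\<sigma> k)" if "k \<le> 2" for k
        using singular_simplex_singular_face [OF \<omega>, of k] that by (simp add: \<sigma>_def)
      then have ch: "singular_chain 1 (top_of_set X) (frag_of (\<sigma> k))" if "k \<le> 2" for k
        using that by (simp add: singular_chain_of)
      have bnd: "chain_boundary 2 (frag_of \<omega>) = frag_of (\<sigma> 0) - frag_of (\<sigma> 1) + frag_of (\<sigma> 2)"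
        by (simp add: chain_boundary_of \<sigma>_def numeral_2_eq_2)
      define u where "u k = h (frag_of (\<sigma> k))" for k
      have u: "u k \<in> carrier deck_group" if "k \<le> 2" for k
        using h(2) [OF \<sigma> [OF that]] hol [OF \<sigma> [OF that]] by (simp only: u_def)
      have u1: "u 1 = u 2 \<otimes>\<^bsub>deck_group\<^esub> u 0"
        using holonomy_2_simplex [OF \<omega>, of n] h(2) [OF \<sigma>] by (simp add: u_def \<sigma>_def)
      have "h (chain_boundary 2 (frag_of \<omega>)) = u 0 \<otimes>\<^bsub>deck_group\<^esub> inv\<^bsub>deck_group\<^esub> (u 1) \<otimes>\<^bsub>deck_group\<^esub> u 2"
        unfolding bnd u_def using ch by (subst hadd hdiff; simp add: singular_chain_diff)+
      also have "\<dots> = (u 2 \<otimes>\<^bsub>deck_group\<^esub> u 0) \<otimes>\<^bsub>deck_group\<^esub> inv\<^bsub>deck_group\<^esub> (u 1)"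
        using u [of 0] u [of 1] u [of 2] m_comm m_assoc inv_closed m_closed by (metis one_le_numeral zero_le order_refl)
      also have "\<dots> = \<one>\<^bsub>deck_group\<^esub>"
        using u1 u [of 1] r_inv by (metis one_le_numeral)
      finally show ?case
        using ch unfolding bnd by (simp add: singular_chain_diff singular_chain_add)
    next
      case (diff a b)
      then show ?case
        using hdiff by (simp add: chain_boundary_diff singular_chain_diff del: deck_group_simps)
    qed
    then show ?thesis by blast
  qed
  let ?\<sigma> = "path_simplex \<gamma>"
  have \<sigma>: "singular_simplex 1 (top_of_set X) ?\<sigma>"
    using \<gamma> singular_simplex_path_simplex by (auto simp: loop_at_def)
  have "h (frag_cmul (int m) (frag_of ?\<sigma>)) = \<one>\<^bsub>deck_group\<^esub>"
    using bd bd0 unfolding singular_boundary by (metis Suc_1)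
  moreover have "h (frag_cmul (int m) (frag_of ?\<sigma>)) = h (frag_of ?\<sigma>) [^]\<^bsub>deck_group\<^esub> m"
    using h.hom_nat_pow [of "frag_of ?\<sigma>" m] \<sigma> by (simp add: singular_chain_of chain_group_def)
  ultimately show ?thesis
    using h(2) [OF \<sigma>] holonomy_path_simplex [OF \<gamma>] by simp
qed

text \<open>If every loop were torsion in homology, the order \<open>k ^ n\<close> of \<open>deck n\<close> would be bounded by a number that does not depend on \<open>n\<close>.\<close>

theorem betti_number_pos:
  assumes SP: "transport_graph X S P"
  shows "betti_number 1 (top_of_set X) > 0"
proof (rule ccontr)
  assume "\<not> betti_number 1 (top_of_set X) > 0"
  then have b0: "betti_number 1 (top_of_set X) = 0"
    by simp
  have comm: "comm_group deck_group"
    by (rule comm_group_deck_group [OF SP])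
  obtain x0 \<Lambda> where \<Lambda>: "x0 \<in> X" "finite \<Lambda>" "\<And>\<gamma>. \<gamma> \<in> \<Lambda> \<Longrightarrow> loop_at x0 \<gamma>"
    "\<And>n y0. y0 \<in> X \<Longrightarrow> (p ^^ n) y0 = x0 \<Longrightarrow> deck n \<subseteq> generate deck_group (monodromy n y0 ` \<Lambda>)"
    using finitely_many_loops_generate [OF SP] by metis
  have "\<exists>m>0. singular_relboundary 1 (top_of_set X) {} (frag_cmul (int m) (frag_of (path_simplex \<gamma>)))"
    if "\<gamma> \<in> \<Lambda>" for \<gamma>
  proof -
    have "singular_relcycle 1 (top_of_set X) {} (frag_of (path_simplex \<gamma>))"
      using \<Lambda>(3) [OF that] relcycle_path_simplex unfolding loop_at_def by metis
    then show ?thesis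
      using torsion_if_betti_number_0 [OF b0] by metis
  qed
  then obtain m where m: "\<And>\<gamma>. \<gamma> \<in> \<Lambda> \<Longrightarrow> m \<gamma> > 0"
    "\<And>\<gamma>. \<gamma> \<in> \<Lambda> \<Longrightarrow> singular_relboundary 1 (top_of_set X) {} (frag_cmul (int (m \<gamma>)) (frag_of (path_simplex \<gamma>)))"
    by metis
  have bound: "k ^ n \<le> (\<Prod>\<gamma>\<in>\<Lambda>. m \<gamma>)" for n
  proof -
    note y0 = lift_point [OF \<Lambda>(1), of n]
    have "card (deck n) \<le> (\<Prod>\<gamma>\<in>\<Lambda>. m \<gamma>)"
    proof (rule comm_group.card_generate_torsion [OF comm \<Lambda>(2)])
      show "monodromy n (lift_point n x0) \<gamma> \<in> carrier deck_group" if "\<gamma> \<in> \<Lambda>" for \<gamma>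
        using monodromy(1) [OF \<Lambda>(3) [OF that] y0] by auto
      show "monodromy n (lift_point n x0) \<gamma> [^]\<^bsub>deck_group\<^esub> m \<gamma> = \<one>\<^bsub>deck_group\<^esub>" if "\<gamma> \<in> \<Lambda>" for \<gamma>
        by (rule monodromy_torsion [OF comm \<Lambda>(3) [OF that] m(2) [OF that]])
    qed (use m \<Lambda>(4) [OF y0] in auto)
    then show ?thesis
      by (simp add: card_deck)
  qed
  define M where "M = (\<Prod>\<gamma>\<in>\<Lambda>. m \<gamma>)"
  have "M < k ^ M"
    by (rule power_gt_expt) (use k in simp)
  then show False
    using bound [of M] by (simp add: M_def)
qed

end

theorem corollary1p5:
  fixes X :: "'a::topological_space set" and p :: "'a \<Rightarrow> 'a"
  assumes "finite_CW_complex (top_of_set X)"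
    and "connected X" and "X \<noteq> {}"
    and "nontrivial_self_cover X p"
    and "strongly_regular_self_cover X p"
  shows "betti_number 1 (top_of_set X) > 0"
proof -
  obtain E d \<Phi> where CW: "CW_structure (top_of_set X) E d \<Phi>" "finite E"
    using assms(1) unfolding finite_CW_complex_def by blast
  obtain k where k: "k > 1" "\<And>y. y \<in> X \<Longrightarrow> card {x \<in> X. p x = y} = k"
    using assms(4) unfolding nontrivial_self_cover_def covering_degree_def by blast
  interpret self_cover_tower X p k
  proof
    show "Hausdorff_space (top_of_set X)"
      using CW(1) by (simp add: CW_structure_def)
    show "regular_covering_space X (p ^^ n) X" if "n \<ge> 1" for n
      using assms(5) that by (simp add: strongly_regular_self_cover_def)
  qed (use assms k in auto)
  obtain S P where "transport_graph X S P"
    by (rule finite_CW_transport_graph [OF CW])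
  then show ?thesis
    by (rule betti_number_pos)
qed

end
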